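(* Let $G$ be a pro-oligomorphic group, let $\mathcal{E}$ be an order in $\mathbf{S}(G)$, and let $\mathfrak{G}$, $\mathfrak{B}(X)$ and $\mathcal{C}$ be associated to $\mathcal{E}$ as in the context. Suppose that $\mathcal{E}$ is odd. Then $\mathcal{C}$ admits a $\mathbf{Z}$-valued measure $\beta$ satisfying $\beta(\mathfrak{B}(X))=(-2)^{\rho(X)-1}$ for all non-empty objects $X$ of $\mathcal{E}$, where $\rho(X)$ is the number of atoms ($G$-orbits) in $X$.
   Context: **Pro-oligomorphic groups and orders.** A pro-oligomorphic group is a Hausdorff topological group $G$ whose open subgroups form a neighborhood basis of $1$ and such that $U\backslash G/V$ is finite for all open subgroups $U,V$. $\mathbf{S}(G)$ is the category of $G$-sets with open point stabilizers and finitely many orbits. An order in $\mathbf{S}(G)$ is a full subcategory containing the one-point set $\mathbf 1$, closed under finite products, finite coproducts and subobjects, and such that every object of $\mathbf{S}(G)$ is a quotient of an object of it. Atoms are the transitive $G$-sets. **Odd.** $\mathcal{E}$ is odd if for all morphisms of atoms $Y\to X$ and $X'\to X$ in $\mathcal{E}$, the fiber product $X'\times_XY$ contains an odd number of atoms. **The category $\mathcal{C}$.** Let $\mathcal{E}^s_1$ be the category whose objects are the non-empty objects of $\mathcal{E}$ and whose morphisms are the surjective $G$-maps. Fix a pro-object $\Omega=(\Omega_i)$ of $\mathcal{E}^s_1$ (indexed by a directed set) that is universal ($\mathrm{Hom}(\Omega,X)\ne\emptyset$ for all $X$) and homogeneous ($\mathrm{Aut}(\Omega)$ acts transitively on $\mathrm{Hom}(\Omega,X)$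 for all $X$); such exists. Let $\mathfrak{G}=\mathrm{Aut}(\Omega)$ and $\mathfrak{B}(X)=\varinjlim_i\mathrm{Surj}(\Omega_i,X)$ with action $g\cdot f=f\circ g^{-1}$. With the topology generated by stabilizers of elements of the $\mathfrak{B}(X)$, $\mathfrak{G}$ is pro-oligomorphic and each $\mathfrak{B}(X)$ is transitive and smooth. $\mathcal{C}$ is the order in $\mathbf{S}(\mathfrak{G})$ of those objects whose orbits are isomorphic to some $\mathfrak{B}(X)$, $X\in\mathcal{E}$ non-empty. Maps $\mathfrak{B}(Y)\to\mathfrak{B}(X)$ correspond bijectively to surjections $Y\to X$. **Measures.** A measure for $\mathcal{C}$ valued in a commutative ring $k$ assigns to each morphism $f\colon Y\to X$ of atoms of $\mathcal{C}$ an element $\mu(f)\in k$ with: $\mu(f)=1$ for isomorphisms; $\mu(g\circ f)=\mu(g)\mu(f)$ when defined; and, if $X'\to X$ is a morphism of atoms and $Y\times_XX'=\bigsqcup_iY'_i$ is the decomposition into atoms with induced maps $f'_i\colon Y'_i\to X'$, then $\mu(f)=\sum_i\mu(f'_i)$. For an atom $X$, $\mu(X)=\mu(X\to\mathbf 1)$. *)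

theory Defs
  imports "HOL-Analysis.Analysis" "HOL-Algebra.Group_Action"
begin

section \<open>Pro-oligomorphic groups\<close>

definition topological_group :: "('g, 'm) monoid_scheme \<Rightarrow> 'g topology \<Rightarrow> bool" where
  "topological_group G T \<longleftrightarrow>
     group G \<and> topspace T = carrier G \<and>
     continuous_map (prod_topology T T) T (\<lambda>(x, y). x \<otimes>\<^bsub>G\<^esub> y) \<and>
     continuous_map T T (\<lambda>x. inv\<^bsub>G\<^esub> x)"

definition open_subgroup :: "('g, 'm) monoid_scheme \<Rightarrow> 'g topology \<Rightarrow> 'g set \<Rightarrow> bool" where
  "open_subgroup G T U \<longleftrightarrow> subgroup U G \<and> openin T U"

definition pro_oligomorphic :: "('g, 'm) monoid_scheme \<Rightarrow> 'g topology \<Rightarrow> bool" where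
  "pro_oligomorphic G T \<longleftrightarrow>
     topological_group G T \<and> Hausdorff_space T \<and>
     (\<forall>W. openin T W \<and> \<one>\<^bsub>G\<^esub> \<in> W \<longrightarrow> (\<exists>U. open_subgroup G T U \<and> U \<subseteq> W)) \<and>
     (\<forall>U V. open_subgroup G T U \<and> open_subgroup G T V \<longrightarrow>
        finite {(U #>\<^bsub>G\<^esub> g) <#>\<^bsub>G\<^esub> V | g. g \<in> carrier G})"


section \<open>\<open>G\<close>-sets and their maps\<close>

record ('g, 'x) gset =
  pts :: "'x set"
  act :: "'g \<Rightarrow> 'x \<Rightarrow> 'x"

definition is_gset :: "('g, 'm) monoid_scheme \<Rightarrow> ('g, 'x) gset \<Rightarrow> bool" where
  "is_gset G X \<longleftrightarrow> group_action G (pts X) (act X)"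

definition gorbits :: "('g, 'm) monoid_scheme \<Rightarrow> ('g, 'x) gset \<Rightarrow> 'x set set" where
  "gorbits G X = orbits G (pts X) (act X)"

text \<open>The objects of the category \<open>S(G)\<close> with underlying set in a given type.\<close>

definition SG :: "('g, 'm) monoid_scheme \<Rightarrow> 'g topology \<Rightarrow> ('g, 'x) gset set" where
  "SG G T = {X. is_gset G X \<and> (\<forall>x\<in>pts X. openin T (stabilizer G (act X) x)) \<and>
                finite (gorbits G X)}"

text \<open>Maps are extensional, so that equality in HOL is equality of maps.\<close>

definition gmaps ::
  "('g, 'm) monoid_scheme \<Rightarrow> ('g, 'x) gset \<Rightarrow> ('g, 'y) gset \<Rightarrow> ('x \<Rightarrow> 'y) set" where
  "gmaps G X Y = {f \<in> pts X \<rightarrow>\<^sub>E pts Y.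
     \<forall>g\<in>carrier G. \<forall>x\<in>pts X. f (act X g x) = act Y g (f x)}"

definition gsurjs ::
  "('g, 'm) monoid_scheme \<Rightarrow> ('g, 'x) gset \<Rightarrow> ('g, 'y) gset \<Rightarrow> ('x \<Rightarrow> 'y) set" where
  "gsurjs G X Y = {f \<in> gmaps G X Y. f ` pts X = pts Y}"

definition ginjs ::
  "('g, 'm) monoid_scheme \<Rightarrow> ('g, 'x) gset \<Rightarrow> ('g, 'y) gset \<Rightarrow> ('x \<Rightarrow> 'y) set" where
  "ginjs G X Y = {f \<in> gmaps G X Y. inj_on f (pts X)}"

definition gisos ::
  "('g, 'm) monoid_scheme \<Rightarrow> ('g, 'x) gset \<Rightarrow> ('g, 'y) gset \<Rightarrow> ('x \<Rightarrow> 'y) set" where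
  "gisos G X Y = {f \<in> gmaps G X Y. bij_betw f (pts X) (pts Y)}"

definition giso ::
  "('g, 'm) monoid_scheme \<Rightarrow> ('g, 'x) gset \<Rightarrow> ('g, 'y) gset \<Rightarrow> bool" where
  "giso G X Y \<longleftrightarrow> gisos G X Y \<noteq> {}"

definition point_gset :: "'x \<Rightarrow> ('g, 'x) gset" where
  "point_gset p = \<lparr>pts = {p}, act = (\<lambda>g. \<lambda>x\<in>{p}. p)\<rparr>"

definition sub_gset :: "('g, 'x) gset \<Rightarrow> 'x set \<Rightarrow> ('g, 'x) gset" where
  "sub_gset X A = \<lparr>pts = A, act = (\<lambda>g. restrict (act X g) A)\<rparr>"

definition prod_gset :: "('g, 'x) gset \<Rightarrow> ('g, 'y) gset \<Rightarrow> ('g, 'x \<times> 'y) gset" where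
  "prod_gset X Y = \<lparr>pts = pts X \<times> pts Y,
     act = (\<lambda>g. \<lambda>(x, y)\<in>pts X \<times> pts Y. (act X g x, act Y g y))\<rparr>"

definition coprod_gset :: "('g, 'x) gset \<Rightarrow> ('g, 'y) gset \<Rightarrow> ('g, 'x + 'y) gset" where
  "coprod_gset X Y = \<lparr>pts = pts X <+> pts Y,
     act = (\<lambda>g. \<lambda>z\<in>pts X <+> pts Y. map_sum (act X g) (act Y g) z)\<rparr>"

definition fiber_prod ::
  "('g, 'x) gset \<Rightarrow> ('x \<Rightarrow> 'z) \<Rightarrow> ('g, 'y) gset \<Rightarrow> ('y \<Rightarrow> 'z) \<Rightarrow> ('g, 'x \<times> 'y) gset" where
  "fiber_prod X f Y h = sub_gset (prod_gset X Y) {(x, y) \<in> pts X \<times> pts Y. f x = h y}"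


section \<open>Orders\<close>

text \<open>
  A full subcategory of \<open>S(G)\<close> is given by its set of objects. Products and coproducts are only
  determined up to isomorphism, and closure means that all \<open>G\<close>-sets representing them belong to
  the subcategory; closure under subobjects makes it closed under isomorphism.

  An order depends on the type of the underlying sets. It should be used only at types \<open>'x\<close> that
  are large enough for every object of \<open>S(G)\<close>, over whatever type, to be isomorphic to
  one over \<open>'x\<close>. The type \<open>nat \<times> 'g set\<close> always has this property, since every transitive object
  is isomorphic to some \<open>G/U\<close>.
\<close>

definition is_order ::
  "('g, 'm) monoid_scheme \<Rightarrow> 'g topology \<Rightarrow> ('g, 'x) gset set \<Rightarrow> bool" where
  "is_order G T E \<longleftrightarrow>
     E \<subseteq> SG G T \<and>
     (\<forall>p. point_gset p \<in> E) \<and>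
     (\<forall>X\<in>E. \<forall>Y\<in>E. \<forall>Z\<in>SG G T. giso G Z (prod_gset X Y) \<longrightarrow> Z \<in> E) \<and>
     (\<forall>Z\<in>SG G T. pts Z = {} \<longrightarrow> Z \<in> E) \<and>
     (\<forall>X\<in>E. \<forall>Y\<in>E. \<forall>Z\<in>SG G T. giso G Z (coprod_gset X Y) \<longrightarrow> Z \<in> E) \<and>
     (\<forall>X\<in>E. \<forall>Z\<in>SG G T. ginjs G Z X \<noteq> {} \<longrightarrow> Z \<in> E) \<and>
     (\<forall>X\<in>(SG G T :: ('g, 'x) gset set). \<exists>Y\<in>E. gsurjs G Y X \<noteq> {})"

definition atoms :: "('g, 'm) monoid_scheme \<Rightarrow> ('g, 'x) gset set \<Rightarrow> ('g, 'x) gset set" where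
  "atoms G E = {X \<in> E. pts X \<noteq> {} \<and> transitive_action G (pts X) (act X)}"

definition odd_order :: "('g, 'm) monoid_scheme \<Rightarrow> ('g, 'x) gset set \<Rightarrow> bool" where
  "odd_order G E \<longleftrightarrow>
     (\<forall>X\<in>atoms G E. \<forall>Y\<in>atoms G E. \<forall>X'\<in>atoms G E. \<forall>f\<in>gmaps G Y X. \<forall>h\<in>gmaps G X' X.
        odd (card (gorbits G (fiber_prod X' h Y f))))"

definition nonempty_objs :: "('g, 'x) gset set \<Rightarrow> ('g, 'x) gset set" where
  "nonempty_objs E = {X \<in> E. pts X \<noteq> {}}"


section \<open>Pro-objects of the category of non-empty objects and surjections\<close>

text \<open>The transition map \<open>tmap P i j\<close> goes from \<open>obj P j\<close> to \<open>obj P i\<close>, for \<open>leq P i j\<close>.\<close>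

record ('i, 'g, 'x) prosys =
  idx :: "'i set"
  leq :: "'i \<Rightarrow> 'i \<Rightarrow> bool"
  obj :: "'i \<Rightarrow> ('g, 'x) gset"
  tmap :: "'i \<Rightarrow> 'i \<Rightarrow> 'x \<Rightarrow> 'x"

definition is_pro_object ::
  "('g, 'm) monoid_scheme \<Rightarrow> ('g, 'x) gset set \<Rightarrow> ('i, 'g, 'x) prosys \<Rightarrow> bool" where
  "is_pro_object G E P \<longleftrightarrow>
     idx P \<noteq> {} \<and>
     (\<forall>i\<in>idx P. leq P i i) \<and>
     (\<forall>i\<in>idx P. \<forall>j\<in>idx P. \<forall>k\<in>idx P. leq P i j \<and> leq P j k \<longrightarrow> leq P i k) \<and>
     (\<forall>i\<in>idx P. \<forall>j\<in>idx P. \<exists>k\<in>idx P. leq P i k \<and> leq P j k) \<and>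
     (\<forall>i\<in>idx P. obj P i \<in> nonempty_objs E) \<and>
     (\<forall>i\<in>idx P. \<forall>j\<in>idx P. leq P i j \<longrightarrow> tmap P i j \<in> gsurjs G (obj P j) (obj P i)) \<and>
     (\<forall>i\<in>idx P. tmap P i i = (\<lambda>x\<in>pts (obj P i). x)) \<and>
     (\<forall>i\<in>idx P. \<forall>j\<in>idx P. \<forall>k\<in>idx P. leq P i j \<and> leq P j k \<longrightarrow>
        tmap P i k = compose (pts (obj P k)) (tmap P i j) (tmap P j k))"

text \<open>
  \<open>germs G P X\<close> is the direct limit of the sets of surjections \<open>obj P i \<rightarrow> X\<close>, that is, the set of
  morphisms from the pro-object \<open>P\<close> to \<open>X\<close>. Its elements are equivalence classes of pairs \<open>(i, f)\<close>.
\<close>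

type_synonym ('i, 'x) germ = "('i \<times> ('x \<Rightarrow> 'x)) set"

definition pre_germs ::
  "('g, 'm) monoid_scheme \<Rightarrow> ('i, 'g, 'x) prosys \<Rightarrow> ('g, 'x) gset \<Rightarrow> ('i \<times> ('x \<Rightarrow> 'x)) set" where
  "pre_germs G P X = (SIGMA i:idx P. gsurjs G (obj P i) X)"

definition germ_rel ::
  "('g, 'm) monoid_scheme \<Rightarrow> ('i, 'g, 'x) prosys \<Rightarrow> ('g, 'x) gset \<Rightarrow>
     (('i \<times> ('x \<Rightarrow> 'x)) \<times> ('i \<times> ('x \<Rightarrow> 'x))) set" where
  "germ_rel G P X = {((i, f), (j, h)). (i, f) \<in> pre_germs G P X \<and> (j, h) \<in> pre_germs G P X \<and>
     (\<exists>k\<in>idx P. leq P i k \<and> leq P j k \<and>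
        compose (pts (obj P k)) f (tmap P i k) = compose (pts (obj P k)) h (tmap P j k))}"

definition germs ::
  "('g, 'm) monoid_scheme \<Rightarrow> ('i, 'g, 'x) prosys \<Rightarrow> ('g, 'x) gset \<Rightarrow> ('i, 'x) germ set" where
  "germs G P X = pre_germs G P X // germ_rel G P X"

text \<open>
  Composition of \<open>b\<close>, a morphism from \<open>P\<close> to some \<open>Y\<close>, with a surjection \<open>f : Y \<rightarrow> X\<close>. The union
  runs over all representatives of \<open>b\<close>, each of which gives the same class.
\<close>

definition germ_push ::
  "('g, 'm) monoid_scheme \<Rightarrow> ('i, 'g, 'x) prosys \<Rightarrow> ('g, 'x) gset \<Rightarrow> ('x \<Rightarrow> 'x) \<Rightarrow>
     ('i, 'x) germ \<Rightarrow> ('i, 'x) germ" where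
  "germ_push G P X f b =
     (\<Union>(k, h)\<in>b. germ_rel G P X `` {(k, compose (pts (obj P k)) f h)})"

text \<open>
  An endomorphism of the pro-object \<open>P\<close> is an element of the inverse limit over \<open>j\<close> of the sets of
  morphisms \<open>P \<rightarrow> obj P j\<close>. The composite of a morphism \<open>a : P \<rightarrow> X\<close>, represented by \<open>(j, f)\<close>,
  with the endomorphism \<open>\<phi>\<close> is the composite of \<open>f\<close> with the component \<open>\<phi> j\<close>.
\<close>

definition germ_comp ::
  "('g, 'm) monoid_scheme \<Rightarrow> ('i, 'g, 'x) prosys \<Rightarrow> ('g, 'x) gset \<Rightarrow>
     ('i, 'x) germ \<Rightarrow> ('i \<Rightarrow> ('i, 'x) germ) \<Rightarrow> ('i, 'x) germ" where
  "germ_comp G P X a \<phi> = (\<Union>(j, f)\<in>a. germ_push G P X f (\<phi> j))"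

definition pro_End ::
  "('g, 'm) monoid_scheme \<Rightarrow> ('i, 'g, 'x) prosys \<Rightarrow> ('i \<Rightarrow> ('i, 'x) germ) monoid" where
  "pro_End G P =
     \<lparr>carrier = {\<phi> \<in> (\<Pi>\<^sub>E j\<in>idx P. germs G P (obj P j)).
        \<forall>i\<in>idx P. \<forall>j\<in>idx P. leq P i j \<longrightarrow> germ_push G P (obj P i) (tmap P i j) (\<phi> j) = \<phi> i},
      mult = (\<lambda>\<phi> \<psi>. \<lambda>j\<in>idx P. germ_comp G P (obj P j) (\<phi> j) \<psi>),
      one = (\<lambda>j\<in>idx P. germ_rel G P (obj P j) `` {(j, \<lambda>x\<in>pts (obj P j). x)})\<rparr>"

definition pro_Aut ::
  "('g, 'm) monoid_scheme \<Rightarrow> ('i, 'g, 'x) prosys \<Rightarrow> ('i \<Rightarrow> ('i, 'x) germ) monoid" where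
  "pro_Aut G P = units_of (pro_End G P)"

definition BB ::
  "('g, 'm) monoid_scheme \<Rightarrow> ('i, 'g, 'x) prosys \<Rightarrow> ('g, 'x) gset \<Rightarrow>
     ('i \<Rightarrow> ('i, 'x) germ, ('i, 'x) germ) gset" where
  "BB G P X = \<lparr>pts = germs G P X,
     act = (\<lambda>\<sigma>. \<lambda>a\<in>germs G P X. germ_comp G P X a (inv\<^bsub>pro_Aut G P\<^esub> \<sigma>))\<rparr>"

definition universal_pro ::
  "('g, 'm) monoid_scheme \<Rightarrow> ('g, 'x) gset set \<Rightarrow> ('i, 'g, 'x) prosys \<Rightarrow> bool" where
  "universal_pro G E P \<longleftrightarrow> (\<forall>X\<in>nonempty_objs E. germs G P X \<noteq> {})"

definition homogeneous_pro ::
  "('g, 'm) monoid_scheme \<Rightarrow> ('g, 'x) gset set \<Rightarrow> ('i, 'g, 'x) prosys \<Rightarrow> bool" where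
  "homogeneous_pro G E P \<longleftrightarrow>
     (\<forall>X\<in>nonempty_objs E. \<forall>a\<in>germs G P X. \<forall>b\<in>germs G P X.
        \<exists>\<sigma>\<in>carrier (pro_Aut G P). germ_comp G P X a \<sigma> = b)"

text \<open>
  The group topology for which the stabilizers are open: besides the stabilizers themselves, their
  left cosets are needed as a subbase (right cosets of stabilizers are left cosets of stabilizers).
\<close>

definition pro_Aut_topology ::
  "('g, 'm) monoid_scheme \<Rightarrow> ('g, 'x) gset set \<Rightarrow> ('i, 'g, 'x) prosys \<Rightarrow>
     ('i \<Rightarrow> ('i, 'x) germ) topology" where
  "pro_Aut_topology G E P = topology_generated_by
     {\<sigma> <#\<^bsub>pro_Aut G P\<^esub> stabilizer (pro_Aut G P) (act (BB G P X)) a | \<sigma> X a.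
        \<sigma> \<in> carrier (pro_Aut G P) \<and> X \<in> nonempty_objs E \<and> a \<in> germs G P X}"

text \<open>
  All objects of \<open>S(pro_Aut G P)\<close> have isomorphic copies over the type \<open>('i, 'x) germ\<close>
  of the elements of the \<open>BB G P X\<close> when \<open>'x\<close> is infinite, so this type suffices for the order
  below.
\<close>

definition CC ::
  "('g, 'm) monoid_scheme \<Rightarrow> ('g, 'x) gset set \<Rightarrow> ('i, 'g, 'x) prosys \<Rightarrow>
     ('i \<Rightarrow> ('i, 'x) germ, ('i, 'x) germ) gset set" where
  "CC G E P = {Z \<in> SG (pro_Aut G P) (pro_Aut_topology G E P).
     \<forall>A\<in>gorbits (pro_Aut G P) Z.
       \<exists>X\<in>nonempty_objs E. giso (pro_Aut G P) (sub_gset Z A) (BB G P X)}"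


section \<open>Measures\<close>

text \<open>
  \<open>\<mu> Y X f\<close> is the value on the morphism \<open>f : Y \<rightarrow> X\<close>. In the last condition the orbits \<open>A\<close> of the
  fiber product, which are \<open>G\<close>-sets over a product type, are represented by isomorphic atoms
  \<open>W A\<close> of \<open>C\<close>, with isomorphisms \<open>e A\<close>.
\<close>

definition order_measure ::
  "('g, 'm) monoid_scheme \<Rightarrow> ('g, 'x) gset set \<Rightarrow>
     (('g, 'x) gset \<Rightarrow> ('g, 'x) gset \<Rightarrow> ('x \<Rightarrow> 'x) \<Rightarrow> 'k::comm_ring_1) \<Rightarrow> bool" where
  "order_measure G C \<mu> \<longleftrightarrow>
     (\<forall>Y\<in>atoms G C. \<forall>X\<in>atoms G C. \<forall>f\<in>gisos G Y X. \<mu> Y X f = 1) \<and>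
     (\<forall>Y\<in>atoms G C. \<forall>X\<in>atoms G C. \<forall>Z\<in>atoms G C. \<forall>f\<in>gmaps G Y X. \<forall>h\<in>gmaps G X Z.
        \<mu> Y Z (compose (pts Y) h f) = \<mu> X Z h * \<mu> Y X f) \<and>
     (\<forall>Y\<in>atoms G C. \<forall>X\<in>atoms G C. \<forall>X'\<in>atoms G C. \<forall>f\<in>gmaps G Y X. \<forall>h\<in>gmaps G X' X.
        \<forall>W e. (\<forall>A\<in>gorbits G (fiber_prod Y f X' h). W A \<in> atoms G C \<and>
                 e A \<in> gisos G (W A) (sub_gset (fiber_prod Y f X' h) A)) \<longrightarrow>
          \<mu> Y X f = (\<Sum>A\<in>gorbits G (fiber_prod Y f X' h).
                       \<mu> (W A) X' (\<lambda>w\<in>pts (W A). snd (e A w))))"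

end

(*
Put beta(f) = (-2)^(rho(Y) - rho(X)) for f : B(Y) -> B(X). Isomorphisms and composites are clear once
rho(X) is known to depend only on B(X). For base change along B(X') -> B(X), the atoms of
B(Y) x_B(X) B(X') are the B(Z), where Z runs over the subobjects of Y x_X X' that surject onto Y and
onto X'. Such a Z is a set of orbits of Y x_X X', and rho(Z) is its size. So one has to show that the
sum of (-2)^rho(Z) is (-2)^(rho(Y) + rho(X') - rho(X)).

The sum over all sets of orbits that meet the preimage of each orbit of X' factors over these orbits,
with factors (1 - 2)^N - 1, where N is the number of orbits in the preimage. By oddness the parity of
N is that of the number of orbits of Y above the same orbit of X. Moebius inversion over the sets of
orbits of Y then accounts for surjectivity onto Y.
*)
theory Submission
  imports Defs
begin

section \<open>Maps of \<open>G\<close>-sets\<close>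

text \<open>With a base c in place of -2 the factors would be (1 + c)^N - 1. The value c = -2 makes
  them depend on the parity of N alone, and parity is all that oddness controls. After the inversion
  only those sets of orbits of Y contribute that contain an odd number of orbits over each orbit of
  X. Over an orbit of X with n orbits of Y above it, their signed count is -2^(n-1), and this is the
  source of the exponent rho(Y) - rho(X). The passage from B(Y) back to Y starts from one fact,
  proved here from homogeneity: every map B(Y) -> B(X) is composition with a surjection Y -> X.
  Isomorphic B(X) and B(Y) thus have surjections both ways between X and Y, hence equal orbit
  counts. Two properties of germs carry the rest: a germ can be cancelled like an epimorphism, and
  any two germs are images of a common one. They turn statements about points of the B(X) into
  statements about surjections in E. Exponents are natural numbers, and a surjection never raises
  the number of orbits, so the subtractions are not truncated.\<close>

lemma gset_closed:
  "is_gset G X \<Longrightarrow> g \<in> carrier G \<Longrightarrow> x \<in> pts X \<Longrightarrow> act X g x \<in> pts X"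
  unfolding is_gset_def by (metis group_action.element_image)

lemma gset_group: "is_gset G X \<Longrightarrow> group G"
  unfolding is_gset_def group_action_def group_hom_def by blast

lemma gset_mult:
  "is_gset G X \<Longrightarrow> g \<in> carrier G \<Longrightarrow> h \<in> carrier G \<Longrightarrow> x \<in> pts X \<Longrightarrow>
     act X (g \<otimes>\<^bsub>G\<^esub> h) x = act X g (act X h x)"
  unfolding is_gset_def by (metis group_action.composition_rule)

lemma gset_one: "is_gset G X \<Longrightarrow> x \<in> pts X \<Longrightarrow> act X \<one>\<^bsub>G\<^esub> x = x"
  unfolding is_gset_def by (metis group_action.id_eq_one restrict_apply')

text \<open>The action of the inverse element supplies the inverse map, which gives bijectivity.
  Extensionality is demanded because \<open>Bij\<close> consists of extensional functions.\<close>

lemma is_gsetI: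
  assumes G: "group G"
    and closed: "\<And>g x. g \<in> carrier G \<Longrightarrow> x \<in> pts X \<Longrightarrow> act X g x \<in> pts X"
    and one: "\<And>x. x \<in> pts X \<Longrightarrow> act X \<one>\<^bsub>G\<^esub> x = x"
    and mult: "\<And>g h x. g \<in> carrier G \<Longrightarrow> h \<in> carrier G \<Longrightarrow> x \<in> pts X \<Longrightarrow>
                 act X (g \<otimes>\<^bsub>G\<^esub> h) x = act X g (act X h x)"
    and ext: "\<And>g. g \<in> carrier G \<Longrightarrow> act X g \<in> extensional (pts X)"
  shows "is_gset G X"
proof -
  interpret group G by (rule G)
  have bij: "act X g \<in> Bij (pts X)" if g: "g \<in> carrier G" for g
  proof -
    have "bij_betw (act X g) (pts X) (pts X)"
      by (rule bij_betw_byWitness[where f' = "act X (inv\<^bsub>G\<^esub> g)"])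
         (use g closed one mult[symmetric, of "inv\<^bsub>G\<^esub> g" g] mult[symmetric, of g "inv\<^bsub>G\<^esub> g"] in auto)
    then show ?thesis using ext[OF g] by (simp add: Bij_def)
  qed
  have "act X \<in> hom G (BijGroup (pts X))"
  proof (rule homI)
    fix g h assume gh: "g \<in> carrier G" "h \<in> carrier G"
    have "act X (g \<otimes>\<^bsub>G\<^esub> h) = compose (pts X) (act X g) (act X h)"
      by (rule extensionalityI[of _ "pts X"]) (use gh ext mult in \<open>auto simp: compose_eq\<close>)
    then show "act X (g \<otimes>\<^bsub>G\<^esub> h) = act X g \<otimes>\<^bsub>BijGroup (pts X)\<^esub> act X h"
      using bij gh by (simp add: BijGroup_def)
  qed (use bij in \<open>simp add: BijGroup_def\<close>)
  then show ?thesis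
    unfolding is_gset_def group_action_def group_hom_def group_hom_axioms_def
    using G group_BijGroup by blast
qed

lemma gmaps_closed: "f \<in> gmaps G X Y \<Longrightarrow> x \<in> pts X \<Longrightarrow> f x \<in> pts Y"
  unfolding gmaps_def by auto

lemma gmaps_equi:
  "f \<in> gmaps G X Y \<Longrightarrow> g \<in> carrier G \<Longrightarrow> x \<in> pts X \<Longrightarrow> f (act X g x) = act Y g (f x)"
  unfolding gmaps_def by auto

lemma gmaps_ext: "f \<in> gmaps G X Y \<Longrightarrow> f \<in> extensional (pts X)"
  unfolding gmaps_def by (auto simp: PiE_iff)

lemma gmaps_eqI:
  "f \<in> gmaps G X Y \<Longrightarrow> h \<in> gmaps G X Y' \<Longrightarrow> (\<And>x. x \<in> pts X \<Longrightarrow> f x = h x) \<Longrightarrow> f = h"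
  by (metis extensionalityI gmaps_ext)

lemma gmaps_compose:
  assumes "is_gset G X" "f \<in> gmaps G X Y" "h \<in> gmaps G Y Z"
  shows "compose (pts X) h f \<in> gmaps G X Z"
  using assms gset_closed[OF assms(1)]
  unfolding gmaps_def by (auto simp: compose_def PiE_iff Pi_iff)

lemma gsurjs_gmaps: "f \<in> gsurjs G X Y \<Longrightarrow> f \<in> gmaps G X Y"
  unfolding gsurjs_def by auto

lemma gsurjs_image: "f \<in> gsurjs G X Y \<Longrightarrow> f ` pts X = pts Y"
  unfolding gsurjs_def by auto

lemma gsurjs_compose:
  assumes "is_gset G X" "f \<in> gsurjs G X Y" "h \<in> gsurjs G Y Z"
  shows "compose (pts X) h f \<in> gsurjs G X Z"
proof -
  have "compose (pts X) h f ` pts X = h ` f ` pts X"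
    by (auto simp: compose_def image_iff)
  then show ?thesis
    using assms gmaps_compose[of G X f Y h Z] unfolding gsurjs_def by simp
qed

lemma gsurjs_id: "is_gset G X \<Longrightarrow> (\<lambda>x\<in>pts X. x) \<in> gsurjs G X X"
  unfolding gsurjs_def gmaps_def by (auto simp: gset_closed)

lemma gisosI:
  "f \<in> gmaps G X Y \<Longrightarrow> inj_on f (pts X) \<Longrightarrow> pts Y \<subseteq> f ` pts X \<Longrightarrow> f \<in> gisos G X Y"
  unfolding gisos_def bij_betw_def gmaps_def by auto

lemma gisosD:
  assumes "f \<in> gisos G X Y"
  shows "f \<in> gmaps G X Y" "inj_on f (pts X)" "f ` pts X = pts Y" "f \<in> gsurjs G X Y"
  using assms unfolding gisos_def gsurjs_def bij_betw_def by auto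

lemma gisos_compose:
  assumes "is_gset G X" "f \<in> gisos G X Y" "h \<in> gisos G Y Z"
  shows "compose (pts X) h f \<in> gisos G X Z"
  using assms gmaps_compose[of G X f Y h Z] bij_betw_compose[of f "pts X" "pts Y" h "pts Z"]
  unfolding gisos_def by simp

lemma gisos_inv:
  assumes X: "is_gset G X" and f: "f \<in> gisos G X Y"
  obtains h where "h \<in> gisos G Y X" "\<And>x. x \<in> pts X \<Longrightarrow> h (f x) = x" "\<And>y. y \<in> pts Y \<Longrightarrow> f (h y) = y"
proof -
  define h where "h = restrict (inv_into (pts X) f) (pts Y)"
  have bij: "bij_betw f (pts X) (pts Y)" using f by (simp add: gisos_def)
  have 1: "h (f x) = x" if "x \<in> pts X" for x
    using that bij by (simp add: h_def bij_betw_apply bij_betw_inv_into_left)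
  have 2: "f (h y) = y" if "y \<in> pts Y" for y
    using that bij by (simp add: h_def bij_betw_inv_into_right)
  have 3: "bij_betw h (pts Y) (pts X)"
    using bij_betw_inv_into[OF bij] by (simp add: h_def cong: bij_betw_cong)
  have "h \<in> gmaps G Y X" unfolding gmaps_def
  proof (intro CollectI conjI ballI)
    show "h \<in> pts Y \<rightarrow>\<^sub>E pts X"
      using bij_betw_apply[OF 3] by (auto simp: h_def)
    fix g y assume gy: "g \<in> carrier G" "y \<in> pts Y"
    then have hy: "h y \<in> pts X" using bij_betw_apply[OF 3] by auto
    have "f (act X g (h y)) = act Y g y"
      using gmaps_equi[OF gisosD(1)[OF f] gy(1) hy] 2[OF gy(2)] by simp
    then show "h (act Y g y) = act X g (h y)"
      using 1[OF gset_closed[OF X gy(1) hy]] by simp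
  qed
  then show thesis using 1 2 3 that unfolding gisos_def by blast
qed

lemma giso_sym: "is_gset G X \<Longrightarrow> giso G X Y \<Longrightarrow> giso G Y X"
  unfolding giso_def by (metis gisos_inv ex_in_conv)

lemma giso_trans: "is_gset G X \<Longrightarrow> giso G X Y \<Longrightarrow> giso G Y Z \<Longrightarrow> giso G X Z"
  unfolding giso_def by (metis gisos_compose ex_in_conv)

section \<open>Germs and the automorphism group of a pro-object\<close>

text \<open>Everything formal about germs, endomorphisms and the action follows from directedness
  and from the surjectivity of the transition maps. Universality and homogeneity are added in
  \<open>universal_homogeneous\<close>.\<close>

locale pro_object =
  fixes G :: "('g, 'm) monoid_scheme" and E :: "('g, 'x) gset set" and P :: "('i, 'g, 'x) prosys"
  assumes pro: "is_pro_object G E P"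
    and gsets: "X \<in> E \<Longrightarrow> is_gset G X"
begin

lemma obj_nonempty: "i \<in> idx P \<Longrightarrow> obj P i \<in> nonempty_objs E"
  using pro unfolding is_pro_object_def by blast

lemma obj_gset: "i \<in> idx P \<Longrightarrow> is_gset G (obj P i)"
  using obj_nonempty gsets unfolding nonempty_objs_def by blast

lemma leq_refl: "i \<in> idx P \<Longrightarrow> leq P i i"
  using pro unfolding is_pro_object_def by blast

lemma leq_trans:
  "i \<in> idx P \<Longrightarrow> j \<in> idx P \<Longrightarrow> k \<in> idx P \<Longrightarrow> leq P i j \<Longrightarrow> leq P j k \<Longrightarrow> leq P i k"
  using pro unfolding is_pro_object_def by blast

lemma directed:
  assumes "i \<in> idx P" "j \<in> idx P"
  obtains k where "k \<in> idx P" "leq P i k" "leq P j k"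
proof -
  have "\<forall>i\<in>idx P. \<forall>j\<in>idx P. \<exists>k\<in>idx P. leq P i k \<and> leq P j k"
    using pro unfolding is_pro_object_def by (elim conjE)
  then show thesis using that assms by blast
qed

lemma tmap_surj: "i \<in> idx P \<Longrightarrow> j \<in> idx P \<Longrightarrow> leq P i j \<Longrightarrow> tmap P i j \<in> gsurjs G (obj P j) (obj P i)"
  using pro unfolding is_pro_object_def by blast

lemma tmap_closed:
  "i \<in> idx P \<Longrightarrow> j \<in> idx P \<Longrightarrow> leq P i j \<Longrightarrow> x \<in> pts (obj P j) \<Longrightarrow> tmap P i j x \<in> pts (obj P i)"
  using tmap_surj gsurjs_gmaps gmaps_closed by metis

lemma tmap_id: "i \<in> idx P \<Longrightarrow> x \<in> pts (obj P i) \<Longrightarrow> tmap P i i x = x"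
  using pro unfolding is_pro_object_def by simp

lemma tmap_trans:
  assumes "i \<in> idx P" "j \<in> idx P" "k \<in> idx P" "leq P i j" "leq P j k" "x \<in> pts (obj P k)"
  shows "tmap P i k x = tmap P i j (tmap P j k x)"
proof -
  have "tmap P i k = compose (pts (obj P k)) (tmap P i j) (tmap P j k)"
    using pro assms unfolding is_pro_object_def by blast
  then show ?thesis using assms by (simp add: compose_eq)
qed

section \<open>Germs and their composition with surjections\<close>

lemma pre_germs_iff: "(i, f) \<in> pre_germs G P X \<longleftrightarrow> i \<in> idx P \<and> f \<in> gsurjs G (obj P i) X"
  unfolding pre_germs_def by auto

lemma germ_rel_iff:
  "((i, f), (j, h)) \<in> germ_rel G P X \<longleftrightarrow>
     (i, f) \<in> pre_germs G P X \<and> (j, h) \<in> pre_germs G P X \<and>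
     (\<exists>k\<in>idx P. leq P i k \<and> leq P j k \<and>
        (\<forall>x\<in>pts (obj P k). f (tmap P i k x) = h (tmap P j k x)))"
proof -
  have "compose A f t = compose A h t' \<longleftrightarrow> (\<forall>x\<in>A. f (t x) = h (t' x))"
    for A :: "'x set" and f h t t' :: "'x \<Rightarrow> 'x"
    by (auto simp: compose_def restrict_def fun_eq_iff)
  then show ?thesis unfolding germ_rel_def by simp
qed

text \<open>Transitivity is where directedness is used: two agreements, at indices \<open>k\<close>
  and \<open>k'\<close>, both persist at an index \<open>n\<close> above them.\<close>

lemma germ_rel_equiv: "equiv (pre_germs G P X) (germ_rel G P X)"
proof (rule equivI)
  show "germ_rel G P X \<subseteq> pre_germs G P X \<times> pre_germs G P X"
    unfolding germ_rel_def by auto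
  show "refl_on (pre_germs G P X) (germ_rel G P X)"
    by (rule refl_onI) (auto simp: germ_rel_iff pre_germs_iff intro!: bexI leq_refl)
  show "sym (germ_rel G P X)"
    by (rule symI) (auto simp: germ_rel_iff, metis)
  show "trans (germ_rel G P X)"
  proof (rule transI, clarify)
    fix i f j h l m
    assume "((i, f), (j, h)) \<in> germ_rel G P X" "((j, h), (l, m)) \<in> germ_rel G P X"
    then obtain k k' where idx: "i \<in> idx P" "j \<in> idx P" "l \<in> idx P" "k \<in> idx P" "k' \<in> idx P"
      and pre: "(i, f) \<in> pre_germs G P X" "(l, m) \<in> pre_germs G P X"
      and le: "leq P i k" "leq P j k" "leq P j k'" "leq P l k'"
      and eq: "\<And>x. x \<in> pts (obj P k) \<Longrightarrow> f (tmap P i k x) = h (tmap P j k x)"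
              "\<And>x. x \<in> pts (obj P k') \<Longrightarrow> h (tmap P j k' x) = m (tmap P l k' x)"
      unfolding germ_rel_iff pre_germs_iff by metis
    obtain n where n: "n \<in> idx P" "leq P k n" "leq P k' n" using directed idx by metis
    have "f (tmap P i n x) = m (tmap P l n x)" if x: "x \<in> pts (obj P n)" for x
    proof -
      have "f (tmap P i n x) = h (tmap P j k (tmap P k n x))"
        using tmap_trans[OF idx(1,4) n(1) le(1) n(2) x] eq(1) tmap_closed[OF idx(4) n(1,2) x] by simp
      also have "\<dots> = h (tmap P j k' (tmap P k' n x))"
        using tmap_trans[OF idx(2,4) n(1) le(2) n(2) x] tmap_trans[OF idx(2,5) n(1) le(3) n(3) x] by simp
      also have "\<dots> = m (tmap P l n x)"
        using tmap_trans[OF idx(3,5) n(1) le(4) n(3) x] eq(2) tmap_closed[OF idx(5) n(1,3) x] by simp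
      finally show ?thesis .
    qed
    then show "((i, f), (l, m)) \<in> germ_rel G P X"
      unfolding germ_rel_iff using pre n leq_trans idx le by blast
  qed
qed

definition germ_of :: "('g, 'x) gset \<Rightarrow> 'i \<Rightarrow> ('x \<Rightarrow> 'x) \<Rightarrow> ('i, 'x) germ" where
  "germ_of X i f = germ_rel G P X `` {(i, f)}"

lemma germ_of_in: "i \<in> idx P \<Longrightarrow> f \<in> gsurjs G (obj P i) X \<Longrightarrow> germ_of X i f \<in> germs G P X"
  unfolding germs_def germ_of_def by (rule quotientI) (simp add: pre_germs_iff)

lemma germE:
  assumes "a \<in> germs G P X"
  obtains i f where "i \<in> idx P" "f \<in> gsurjs G (obj P i) X" "a = germ_of X i f"
proof -
  obtain z where "z \<in> pre_germs G P X" "a = germ_rel G P X `` {z}"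
    using assms unfolding germs_def by (rule quotientE)
  then show thesis using that[of "fst z" "snd z"] pre_germs_iff[of "fst z" "snd z"] by (simp add: germ_of_def)
qed

lemma germ_of_eqI:
  assumes "i \<in> idx P" "j \<in> idx P" "f \<in> gsurjs G (obj P i) X" "h \<in> gsurjs G (obj P j) X"
    and "k \<in> idx P" "leq P i k" "leq P j k"
    and "\<And>x. x \<in> pts (obj P k) \<Longrightarrow> f (tmap P i k x) = h (tmap P j k x)"
  shows "germ_of X i f = germ_of X j h"
  unfolding germ_of_def by (rule equiv_class_eq[OF germ_rel_equiv]) (use assms in \<open>auto simp: germ_rel_iff pre_germs_iff\<close>)

lemma germ_of_eqD:
  assumes "i \<in> idx P" "j \<in> idx P" "f \<in> gsurjs G (obj P i) X" "h \<in> gsurjs G (obj P j) X"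
    and "germ_of X i f = germ_of X j h"
  obtains k where "k \<in> idx P" "leq P i k" "leq P j k"
    "\<And>x. x \<in> pts (obj P k) \<Longrightarrow> f (tmap P i k x) = h (tmap P j k x)"
proof -
  have "((i, f), (j, h)) \<in> germ_rel G P X"
    using eq_equiv_class[OF assms(5)[unfolded germ_of_def] germ_rel_equiv] assms by (simp add: pre_germs_iff)
  then show thesis using that unfolding germ_rel_iff by blast
qed

lemma germ_of_tmap:
  assumes "i \<in> idx P" "k \<in> idx P" "leq P i k" "f \<in> gsurjs G (obj P i) X"
  shows "germ_of X i f = germ_of X k (compose (pts (obj P k)) f (tmap P i k))"
  by (rule germ_of_eqI[where k = k])
     (use assms gsurjs_compose[OF obj_gset tmap_surj] in
       \<open>auto simp: leq_refl tmap_id compose_eq tmap_closed\<close>)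

text \<open>The union in \<open>germ_push\<close> runs over a nonempty class and its terms are all
  equal: representatives that agree at the index \<open>l\<close> still agree there after
  composition with \<open>f\<close>.\<close>

lemma germ_push_of:
  assumes i: "i \<in> idx P" "h \<in> gsurjs G (obj P i) Y" and f: "f \<in> gsurjs G Y X"
  shows "germ_push G P X f (germ_of Y i h) = germ_of X i (compose (pts (obj P i)) f h)"
proof -
  have eq: "germ_of X k (compose (pts (obj P k)) f h') = germ_of X i (compose (pts (obj P i)) f h)"
    if r: "((i, h), (k, h')) \<in> germ_rel G P Y" for k h'
  proof -
    obtain l where l: "k \<in> idx P" "h' \<in> gsurjs G (obj P k) Y" "l \<in> idx P" "leq P i l" "leq P k l"
      "\<And>x. x \<in> pts (obj P l) \<Longrightarrow> h (tmap P i l x) = h' (tmap P k l x)"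
      using r unfolding germ_rel_iff pre_germs_iff by blast
    show ?thesis
      by (rule germ_of_eqI[where k = l])
         (use l i f gsurjs_compose[OF obj_gset] in \<open>auto simp: compose_eq tmap_closed\<close>)
  qed
  have "((i, h), (i, h)) \<in> germ_rel G P Y"
    using germ_rel_equiv i unfolding equiv_def refl_on_def by (auto simp: pre_germs_iff)
  then have ne: "germ_of Y i h \<noteq> {}" unfolding germ_of_def by blast
  have "germ_push G P X f (germ_of Y i h) =
      (\<Union>z\<in>germ_of Y i h. germ_of X i (compose (pts (obj P i)) f h))"
    unfolding germ_push_def germ_of_def[symmetric]
    by (rule SUP_cong) (use eq in \<open>auto simp: germ_of_def[of Y]\<close>)
  then show ?thesis using ne by (simp only: UN_constant if_False)
qed

lemma germ_push_in:
  assumes "f \<in> gsurjs G Y X" "b \<in> germs G P Y"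
  shows "germ_push G P X f b \<in> germs G P X"
proof -
  obtain i m where i: "i \<in> idx P" "m \<in> gsurjs G (obj P i) Y" and b: "b = germ_of Y i m"
    using assms germE by metis
  show ?thesis unfolding b germ_push_of[OF i assms(1)]
    by (rule germ_of_in[OF i(1) gsurjs_compose[OF obj_gset[OF i(1)] i(2) assms(1)]])
qed

lemma germ_push_compose:
  assumes "is_gset G Z" "h \<in> gsurjs G Z Y" "f \<in> gsurjs G Y X" "c \<in> germs G P Z"
  shows "germ_push G P X (compose (pts Z) f h) c = germ_push G P X f (germ_push G P Y h c)"
proof -
  obtain i m where i: "i \<in> idx P" "m \<in> gsurjs G (obj P i) Z" and c: "c = germ_of Z i m"
    using assms germE by metis
  let ?A = "pts (obj P i)"
  have hm: "compose ?A h m \<in> gsurjs G (obj P i) Y"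
    using gsurjs_compose obj_gset i assms by blast
  have fh: "compose (pts Z) f h \<in> gsurjs G Z X"
    using gsurjs_compose assms by blast
  have "compose ?A (compose (pts Z) f h) m = compose ?A f (compose ?A h m)"
    using gmaps_closed[OF gsurjs_gmaps[OF i(2)]] by (auto simp: compose_def restrict_def fun_eq_iff)
  then show ?thesis
    unfolding c germ_push_of[OF i fh] germ_push_of[OF i assms(2)] germ_push_of[OF i(1) hm assms(3)] by simp
qed

lemma germ_push_id:
  assumes "is_gset G X" "b \<in> germs G P X"
  shows "germ_push G P X (\<lambda>x\<in>pts X. x) b = b"
proof -
  obtain i m where i: "i \<in> idx P" "m \<in> gsurjs G (obj P i) X" and b: "b = germ_of X i m"
    using assms germE by metis
  have "compose (pts (obj P i)) (\<lambda>x\<in>pts X. x) m = m"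
    using gmaps_closed[OF gsurjs_gmaps[OF i(2)]] gmaps_ext[OF gsurjs_gmaps[OF i(2)]]
    by (auto simp: compose_def fun_eq_iff restrict_def extensional_def)
  then show ?thesis unfolding b using germ_push_of[OF i gsurjs_id] assms by simp
qed

text \<open>Germs behave like epimorphisms. The representing map and the transition maps are onto,
  so agreement at a late index already covers every point of \<open>Y\<close>. A single germ
  \<open>b\<close> therefore suffices to compare \<open>f\<close> and \<open>h\<close>.\<close>

lemma germ_push_inj:
  assumes f: "f \<in> gsurjs G Y X" and h: "h \<in> gsurjs G Y X" and b: "b \<in> germs G P Y"
    and eq: "germ_push G P X f b = germ_push G P X h b"
  shows "f = h"
proof -
  obtain i m where i: "i \<in> idx P" "m \<in> gsurjs G (obj P i) Y" and bm: "b = germ_of Y i m"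
    using b germE by metis
  have surj: "compose (pts (obj P i)) f m \<in> gsurjs G (obj P i) X" "compose (pts (obj P i)) h m \<in> gsurjs G (obj P i) X"
    using gsurjs_compose obj_gset i f h by blast+
  then obtain k where k: "k \<in> idx P" "leq P i k"
    and e: "\<And>x. x \<in> pts (obj P k) \<Longrightarrow>
       compose (pts (obj P i)) f m (tmap P i k x) = compose (pts (obj P i)) h m (tmap P i k x)"
    using germ_of_eqD[OF i(1) i(1)] eq unfolding bm germ_push_of[OF i f] germ_push_of[OF i h] by metis
  show ?thesis
  proof (rule gmaps_eqI[OF gsurjs_gmaps[OF f] gsurjs_gmaps[OF h]])
    fix y assume "y \<in> pts Y"
    then obtain z where z: "z \<in> pts (obj P i)" "y = m z" using gsurjs_image[OF i(2)] by blast
    then obtain x where "x \<in> pts (obj P k)" "z = tmap P i k x"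
      using gsurjs_image[OF tmap_surj[OF i(1) k]] by blast
    then show "f y = h y" using e[of x] z by (simp add: compose_eq)
  qed
qed

text \<open>Both germs have representatives at a common index \<open>k\<close>. Take
  \<open>W\<close> to be \<open>obj P k\<close> and \<open>c\<close> to be the germ of its identity
  map. Together with \<open>germ_push_inj\<close> this replaces a pair of germs by a pair of
  surjections out of one object.\<close>

lemma germ_joint_lift:
  assumes "a \<in> germs G P X" "b \<in> germs G P Y"
  obtains W c f h where "W \<in> nonempty_objs E" "c \<in> germs G P W" "f \<in> gsurjs G W X" "h \<in> gsurjs G W Y"
    "a = germ_push G P X f c" "b = germ_push G P Y h c"
proof -
  obtain i m where i: "i \<in> idx P" "m \<in> gsurjs G (obj P i) X" and a: "a = germ_of X i m"
    using assms germE by metis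
  obtain j n where j: "j \<in> idx P" "n \<in> gsurjs G (obj P j) Y" and b: "b = germ_of Y j n"
    using assms germE by metis
  obtain k where k: "k \<in> idx P" "leq P i k" "leq P j k" using directed i j by metis
  let ?W = "obj P k"
  have g: "is_gset G ?W" by (rule obj_gset[OF k(1)])
  have *: "germ_push G P Z p (germ_of ?W k (\<lambda>x\<in>pts ?W. x)) = germ_of Z k p"
    if p: "p \<in> gsurjs G ?W Z" for Z p
  proof -
    have "compose (pts ?W) p (\<lambda>x\<in>pts ?W. x) = p"
      using gmaps_ext[OF gsurjs_gmaps[OF p]] by (auto simp: compose_def fun_eq_iff restrict_def extensional_def)
    then show ?thesis using germ_push_of[OF k(1) gsurjs_id[OF g] p] by simp
  qed
  have s: "compose (pts ?W) m (tmap P i k) \<in> gsurjs G ?W X" "compose (pts ?W) n (tmap P j k) \<in> gsurjs G ?W Y"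
    using gsurjs_compose g tmap_surj i j k by blast+
  show thesis
    by (rule that[OF obj_nonempty[OF k(1)] germ_of_in[OF k(1) gsurjs_id[OF g]] s])
       (simp_all only: a b *[OF s(1)] *[OF s(2)] germ_of_tmap[OF i(1) k(1,2) i(2)] germ_of_tmap[OF j(1) k(1,3) j(2)])
qed

section \<open>Endomorphisms, automorphisms and the action on germs\<close>

lemma End_carrier:
  assumes "\<phi> \<in> carrier (pro_End G P)"
  shows "j \<in> idx P \<Longrightarrow> \<phi> j \<in> germs G P (obj P j)" "\<phi> \<in> extensional (idx P)"
    "i \<in> idx P \<Longrightarrow> j \<in> idx P \<Longrightarrow> leq P i j \<Longrightarrow> germ_push G P (obj P i) (tmap P i j) (\<phi> j) = \<phi> i"
  using assms unfolding pro_End_def by (auto simp: PiE_iff)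

text \<open>As for \<open>germ_push_of\<close>, the union is constant. Independence of the
  representative now comes from the compatibility of the components of \<open>\<phi>\<close> with
  the transition maps, which allows two representatives to be compared at a common later
  index.\<close>

lemma germ_comp_of:
  assumes phi: "\<phi> \<in> carrier (pro_End G P)" and i: "i \<in> idx P" "f \<in> gsurjs G (obj P i) X"
  shows "germ_comp G P X (germ_of X i f) \<phi> = germ_push G P X f (\<phi> i)"
proof -
  have up: "germ_push G P X f (\<phi> i) = germ_push G P X (compose (pts (obj P k)) f (tmap P i k)) (\<phi> k)"
    if "i \<in> idx P" "f \<in> gsurjs G (obj P i) X" "k \<in> idx P" "leq P i k" for i k f
    using germ_push_compose[OF obj_gset[OF that(3)] tmap_surj[OF that(1,3,4)] that(2) End_carrier(1)[OF phi that(3)]]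
      End_carrier(3)[OF phi that(1,3,4)] by simp
  have eq: "germ_push G P X h (\<phi> j) = germ_push G P X f (\<phi> i)"
    if r: "((i, f), (j, h)) \<in> germ_rel G P X" for j h
  proof -
    obtain k where k: "j \<in> idx P" "h \<in> gsurjs G (obj P j) X" "k \<in> idx P" "leq P i k" "leq P j k"
      "\<And>x. x \<in> pts (obj P k) \<Longrightarrow> f (tmap P i k x) = h (tmap P j k x)"
      using r unfolding germ_rel_iff pre_germs_iff by blast
    then have "compose (pts (obj P k)) f (tmap P i k) = compose (pts (obj P k)) h (tmap P j k)"
      by (auto simp: compose_def restrict_def fun_eq_iff)
    then show ?thesis using up[OF i k(3,4)] up[OF k(1,2,3,5)] by simp
  qed
  have "((i, f), (i, f)) \<in> germ_rel G P X"
    using germ_rel_equiv i unfolding equiv_def refl_on_def by (auto simp: pre_germs_iff)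
  then have ne: "germ_of X i f \<noteq> {}" unfolding germ_of_def by blast
  have "germ_comp G P X (germ_of X i f) \<phi> = (\<Union>z\<in>germ_of X i f. germ_push G P X f (\<phi> i))"
    unfolding germ_comp_def
    by (rule SUP_cong) (use eq in \<open>auto simp: germ_of_def[of X]\<close>)
  then show ?thesis using ne by (simp only: UN_constant if_False)
qed

lemma germ_comp_in:
  assumes "\<phi> \<in> carrier (pro_End G P)" "a \<in> germs G P X"
  shows "germ_comp G P X a \<phi> \<in> germs G P X"
proof -
  obtain i m where i: "i \<in> idx P" "m \<in> gsurjs G (obj P i) X" and a: "a = germ_of X i m"
    using assms germE by metis
  show ?thesis unfolding a germ_comp_of[OF assms(1) i]
    by (rule germ_push_in[OF i(2) End_carrier(1)[OF assms(1) i(1)]])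
qed

lemma germ_comp_push:
  assumes "\<phi> \<in> carrier (pro_End G P)" "f \<in> gsurjs G Y X" "b \<in> germs G P Y"
  shows "germ_comp G P X (germ_push G P X f b) \<phi> = germ_push G P X f (germ_comp G P Y b \<phi>)"
proof -
  obtain i m where i: "i \<in> idx P" "m \<in> gsurjs G (obj P i) Y" and b: "b = germ_of Y i m"
    using assms germE by metis
  then show ?thesis
    using assms gsurjs_compose[OF obj_gset[OF i(1)] i(2) assms(2)]
    by (simp add: germ_push_of germ_comp_of germ_push_compose obj_gset End_carrier)
qed

lemma End_mult:
  "j \<in> idx P \<Longrightarrow> (\<phi> \<otimes>\<^bsub>pro_End G P\<^esub> \<psi>) j = germ_comp G P (obj P j) (\<phi> j) \<psi>"
  unfolding pro_End_def by simp

lemma End_one: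
  "j \<in> idx P \<Longrightarrow> \<one>\<^bsub>pro_End G P\<^esub> j = germ_of (obj P j) j (\<lambda>x\<in>pts (obj P j). x)"
  unfolding pro_End_def germ_of_def by simp

lemma End_mult_closed:
  assumes "\<phi> \<in> carrier (pro_End G P)" "\<psi> \<in> carrier (pro_End G P)"
  shows "\<phi> \<otimes>\<^bsub>pro_End G P\<^esub> \<psi> \<in> carrier (pro_End G P)"
proof -
  let ?m = "\<phi> \<otimes>\<^bsub>pro_End G P\<^esub> \<psi>"
  have "?m j \<in> germs G P (obj P j)" if "j \<in> idx P" for j
    using that assms by (simp add: End_mult germ_comp_in End_carrier)
  moreover have "germ_push G P (obj P i) (tmap P i j) (?m j) = ?m i"
    if ij: "i \<in> idx P" "j \<in> idx P" "leq P i j" for i j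
    using ij assms by (simp add: End_mult End_carrier tmap_surj flip: germ_comp_push)
  moreover have "?m \<in> extensional (idx P)" by (simp add: pro_End_def)
  ultimately show ?thesis by (simp add: pro_End_def PiE_iff)
qed

lemma End_one_closed: "\<one>\<^bsub>pro_End G P\<^esub> \<in> carrier (pro_End G P)"
proof -
  have "germ_push G P (obj P i) (tmap P i j) (germ_of (obj P j) j (\<lambda>x\<in>pts (obj P j). x)) =
        germ_of (obj P i) i (\<lambda>x\<in>pts (obj P i). x)"
    if ij: "i \<in> idx P" "j \<in> idx P" "leq P i j" for i j
    unfolding germ_push_of[OF ij(2) gsurjs_id[OF obj_gset[OF ij(2)]] tmap_surj[OF ij]]
    by (rule germ_of_eqI[where k = j])
       (use ij gsurjs_id[OF obj_gset] gsurjs_compose[OF obj_gset gsurjs_id[OF obj_gset] tmap_surj] in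
         \<open>auto simp: leq_refl tmap_id compose_eq tmap_closed\<close>)
  moreover have "germ_of (obj P j) j (\<lambda>x\<in>pts (obj P j). x) \<in> germs G P (obj P j)"
    if "j \<in> idx P" for j using that germ_of_in gsurjs_id obj_gset by blast
  ultimately show ?thesis unfolding pro_End_def germ_of_def by simp
qed

lemma germ_comp_mult:
  assumes "\<phi> \<in> carrier (pro_End G P)" "\<psi> \<in> carrier (pro_End G P)" "a \<in> germs G P X"
  shows "germ_comp G P X a (\<phi> \<otimes>\<^bsub>pro_End G P\<^esub> \<psi>) = germ_comp G P X (germ_comp G P X a \<phi>) \<psi>"
proof -
  obtain i m where i: "i \<in> idx P" "m \<in> gsurjs G (obj P i) X" and a: "a = germ_of X i m"
    using assms germE by metis
  then show ?thesis
    using assms by (simp add: germ_comp_of End_mult_closed End_mult germ_comp_push End_carrier)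
qed

lemma germ_comp_one:
  assumes "a \<in> germs G P X"
  shows "germ_comp G P X a \<one>\<^bsub>pro_End G P\<^esub> = a"
proof -
  obtain i m where i: "i \<in> idx P" "m \<in> gsurjs G (obj P i) X" and a: "a = germ_of X i m"
    using assms germE by metis
  have "compose (pts (obj P i)) m (\<lambda>x\<in>pts (obj P i). x) = m"
    using gmaps_ext[OF gsurjs_gmaps[OF i(2)]] by (auto simp: compose_def fun_eq_iff restrict_def extensional_def)
  then show ?thesis
    unfolding a using i by (simp add: germ_comp_of End_one_closed End_one germ_push_of gsurjs_id obj_gset)
qed

lemma End_ext:
  assumes "\<phi> \<in> carrier (pro_End G P)" "\<psi> \<in> carrier (pro_End G P)" "\<And>j. j \<in> idx P \<Longrightarrow> \<phi> j = \<psi> j"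
  shows "\<phi> = \<psi>"
  using assms End_carrier(2) extensionalityI by metis

lemma End_monoid: "monoid (pro_End G P)"
proof
  fix \<phi> \<psi> \<theta>
  assume c: "\<phi> \<in> carrier (pro_End G P)" "\<psi> \<in> carrier (pro_End G P)" "\<theta> \<in> carrier (pro_End G P)"
  show "\<phi> \<otimes>\<^bsub>pro_End G P\<^esub> \<psi> \<otimes>\<^bsub>pro_End G P\<^esub> \<theta> = \<phi> \<otimes>\<^bsub>pro_End G P\<^esub> (\<psi> \<otimes>\<^bsub>pro_End G P\<^esub> \<theta>)"
    by (rule End_ext) (use c in \<open>auto simp: End_mult_closed End_mult germ_comp_mult End_carrier\<close>)
next
  fix \<phi> assume c: "\<phi> \<in> carrier (pro_End G P)"
  show "\<one>\<^bsub>pro_End G P\<^esub> \<otimes>\<^bsub>pro_End G P\<^esub> \<phi> = \<phi>"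
    by (rule End_ext)
       (use c in \<open>auto simp: End_mult_closed End_one_closed End_mult End_one germ_comp_of gsurjs_id obj_gset
          germ_push_id End_carrier\<close>)
  show "\<phi> \<otimes>\<^bsub>pro_End G P\<^esub> \<one>\<^bsub>pro_End G P\<^esub> = \<phi>"
    by (rule End_ext)
       (use c in \<open>auto simp: End_mult_closed End_one_closed End_mult germ_comp_one End_carrier\<close>)
qed (auto simp: End_mult_closed End_one_closed)

lemma Aut_group: "group (pro_Aut G P)"
  unfolding pro_Aut_def by (rule monoid.units_group[OF End_monoid])

lemma Aut_End: "\<sigma> \<in> carrier (pro_Aut G P) \<Longrightarrow> \<sigma> \<in> carrier (pro_End G P)"
  unfolding pro_Aut_def units_of_carrier Units_def by auto

lemma BB_pts [simp]: "pts (BB G P X) = germs G P X"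
  unfolding BB_def by simp

lemma BB_act:
  "a \<in> germs G P X \<Longrightarrow> act (BB G P X) \<sigma> a = germ_comp G P X a (inv\<^bsub>pro_Aut G P\<^esub> \<sigma>)"
  unfolding BB_def by simp

text \<open>By \<open>germ_comp_mult\<close>, precomposition is a right action of the endomorphisms.
  The inverse in the definition of \<open>BB\<close> makes it a left action.\<close>

lemma BB_gset: "is_gset (pro_Aut G P) (BB G P X)"
proof (rule is_gsetI[OF Aut_group])
  interpret A: group "pro_Aut G P" by (rule Aut_group)
  fix \<sigma> \<tau> a assume \<sigma>: "\<sigma> \<in> carrier (pro_Aut G P)"
  show "act (BB G P X) \<sigma> \<in> extensional (pts (BB G P X))"
    by (simp add: BB_def)
  assume a: "a \<in> pts (BB G P X)"
  then show "act (BB G P X) \<sigma> a \<in> pts (BB G P X)"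
    using \<sigma> by (simp add: BB_act germ_comp_in Aut_End)
  assume \<tau>: "\<tau> \<in> carrier (pro_Aut G P)"
  have "x \<otimes>\<^bsub>pro_Aut G P\<^esub> y = x \<otimes>\<^bsub>pro_End G P\<^esub> y" for x y
    by (simp add: pro_Aut_def units_of_mult)
  then have "germ_comp G P X a (inv\<^bsub>pro_Aut G P\<^esub> \<tau> \<otimes>\<^bsub>pro_Aut G P\<^esub> inv\<^bsub>pro_Aut G P\<^esub> \<sigma>) =
      germ_comp G P X (germ_comp G P X a (inv\<^bsub>pro_Aut G P\<^esub> \<tau>)) (inv\<^bsub>pro_Aut G P\<^esub> \<sigma>)"
    using \<sigma> \<tau> a by (simp add: Aut_End germ_comp_mult)
  then show "act (BB G P X) (\<sigma> \<otimes>\<^bsub>pro_Aut G P\<^esub> \<tau>) a = act (BB G P X) \<sigma> (act (BB G P X) \<tau> a)"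
    using \<sigma> \<tau> a by (simp add: BB_act A.inv_mult_group germ_comp_in Aut_End)
next
  interpret A: group "pro_Aut G P" by (rule Aut_group)
  fix a assume a: "a \<in> pts (BB G P X)"
  have "germ_comp G P X a \<one>\<^bsub>pro_Aut G P\<^esub> = a"
    using a by (simp add: pro_Aut_def units_of_one germ_comp_one)
  then show "act (BB G P X) \<one>\<^bsub>pro_Aut G P\<^esub> a = a"
    using a by (simp add: BB_act)
qed

text \<open>Composition after a germ commutes with precomposition by an automorphism, so each
  surjection \<open>Y\<close> to \<open>X\<close> induces an equivariant map of the sets of germs.
  The converse is \<open>map_from_surj\<close>.\<close>

lemma act_push:
  "f \<in> gsurjs G Y X \<Longrightarrow> \<sigma> \<in> carrier (pro_Aut G P) \<Longrightarrow> b \<in> germs G P Y \<Longrightarrow>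
     act (BB G P X) \<sigma> (germ_push G P X f b) = germ_push G P X f (act (BB G P Y) \<sigma> b)"
  using group.inv_closed[OF Aut_group] by (simp add: germ_push_in BB_act germ_comp_push Aut_End)

end

section \<open>Counting amalgams\<close>

lemma sum_Pow_power_card:
  fixes c :: "'a::comm_ring_1"
  assumes "finite A"
  shows "(\<Sum>S\<in>Pow A. c ^ card S) = (c + 1) ^ card A"
  using prod_add[OF assms, of "\<lambda>_. c" "\<lambda>_. 1"] by simp

text \<open>Choosing a subset of \<open>Q\<close> means choosing a subset of each fibre of
  \<open>q\<close>, and \<open>c ^ card\<close> turns the disjoint union of these choices into a
  product. The condition \<open>R\<close> on fibres is a parameter because the argument uses it
  twice, for nonempty fibres and for fibres of odd size.\<close>

lemma sum_fibrewise_power_card: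
  fixes c :: "'c::comm_ring_1"
  assumes "finite Q" "finite J" and q: "q ` Q \<subseteq> J"
  shows "(\<Sum>Z | Z \<subseteq> Q \<and> (\<forall>j\<in>J. R {z\<in>Z. q z = j}). c ^ card Z) =
         (\<Prod>j\<in>J. \<Sum>S | S \<subseteq> {z\<in>Q. q z = j} \<and> R S. c ^ card S)"
proof -
  let ?B = "\<lambda>j. {S. S \<subseteq> {z\<in>Q. q z = j} \<and> R S}"
  have "(\<Prod>j\<in>J. \<Sum>S\<in>?B j. c ^ card S) = (\<Sum>F\<in>PiE J ?B. \<Prod>j\<in>J. c ^ card (F j))"
    using assms by (subst prod_sum_PiE) auto
  also have "\<dots> = (\<Sum>Z | Z \<subseteq> Q \<and> (\<forall>j\<in>J. R {z\<in>Z. q z = j}). c ^ card Z)"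
  proof (rule sum.reindex_bij_witness[where i = "\<lambda>Z. \<lambda>j\<in>J. {z\<in>Z. q z = j}" and j = "\<lambda>F. \<Union>j\<in>J. F j"])
    fix F assume F: "F \<in> PiE J ?B"
    then have FB: "F j \<subseteq> {z\<in>Q. q z = j}" "R (F j)" if "j \<in> J" for j using that by auto
    have fib: "{z \<in> (\<Union>j\<in>J. F j). q z = j} = F j" if "j \<in> J" for j using that FB by blast
    then show "(\<lambda>j\<in>J. {z\<in>(\<Union>j\<in>J. F j). q z = j}) = F"
      using F by (auto simp: PiE_iff extensional_def fun_eq_iff)
    show "(\<Union>j\<in>J. F j) \<in> {Z. Z \<subseteq> Q \<and> (\<forall>j\<in>J. R {z\<in>Z. q z = j})}"
      using FB fib by fastforce
    have "card (\<Union>j\<in>J. F j) = (\<Sum>j\<in>J. card (F j))"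
    proof (rule card_UN_disjoint)
      show "\<forall>j\<in>J. finite (F j)" using FB \<open>finite Q\<close> by (metis (no_types, lifting) finite_subset mem_Collect_eq subsetI)
      show "\<forall>i\<in>J. \<forall>j\<in>J. i \<noteq> j \<longrightarrow> F i \<inter> F j = {}" using FB by blast
    qed fact
    then show "c ^ card (\<Union>j\<in>J. F j) = (\<Prod>j\<in>J. c ^ card (F j))"
      by (simp add: power_sum)
  next
    fix Z assume "Z \<in> {Z. Z \<subseteq> Q \<and> (\<forall>j\<in>J. R {z\<in>Z. q z = j})}"
    then show "(\<lambda>j\<in>J. {z\<in>Z. q z = j}) \<in> PiE J ?B" "(\<Union>j\<in>J. (\<lambda>j\<in>J. {z\<in>Z. q z = j}) j) = Z"
      using q by auto
  qed
  finally show ?thesis by simp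
qed

lemma sum_odd_subsets:
  assumes "finite F" "F \<noteq> {}"
  shows "(\<Sum>S | S \<subseteq> F \<and> odd (card S). (- 1 :: int) ^ card S) = - (2 ^ (card F - 1))"
proof -
  \<comment> \<open>The term \<open>(- 1) ^ card S - 1\<close> is -2 for odd and 0 for even
    \<open>card S\<close>, so its sum over all subsets is twice the sum over the odd ones. Since
    \<open>F\<close> is nonempty, \<open>0 ^ card F\<close> vanishes below.\<close>
  have "2 * (\<Sum>S | S \<subseteq> F \<and> odd (card S). (- 1 :: int) ^ card S) =
        (\<Sum>S\<in>Pow F. (- 1) ^ card S - 1)"
    unfolding sum_distrib_left
    by (rule sum.mono_neutral_cong_left) (use assms in auto)
  also have "\<dots> = 0 ^ card F - 2 ^ card F"
    using assms sum_Pow_power_card[of F "- 1 :: int"] by (simp add: sum_subtractf card_Pow)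
  also have "\<dots> = - (2 * 2 ^ (card F - 1))"
    using assms by (simp add: card_gt_0_iff power_0_left flip: power_Suc)
  finally show ?thesis by simp
qed

text \<open>This is where the base -2 matters: the sum over all subsets is
  \<open>(- 1) ^ card F\<close>, and removing the empty set subtracts 1.\<close>

lemma sum_nonempty_subsets:
  assumes "finite F"
  shows "(\<Sum>S | S \<subseteq> F \<and> S \<noteq> {}. (- 2 :: int) ^ card S) = (if odd (card F) then - 2 else 0)"
proof -
  have "{S. S \<subseteq> F \<and> S \<noteq> {}} = Pow F - {{}}" by auto
  then have "(\<Sum>S | S \<subseteq> F \<and> S \<noteq> {}. (- 2 :: int) ^ card S) = (- 1) ^ card F - 1"
    using assms sum_Pow_power_card[of F "- 2 :: int"] by (simp add: sum_diff1)
  then show ?thesis by simp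
qed

lemma odd_card_fibres:
  assumes "finite A" "finite S" "p ` S \<subseteq> A" "\<And>i. i \<in> A \<Longrightarrow> odd (card {z\<in>S. p z = i})"
  shows "odd (card S) \<longleftrightarrow> odd (card A)"
proof -
  have "card S = (\<Sum>i\<in>A. card {z\<in>S. p z = i})"
    using sum.group[OF assms(2,1,3), of "\<lambda>_. 1::nat"] by simp
  moreover have "{i\<in>A. odd (card {z\<in>S. p z = i})} = A" using assms(4) by auto
  ultimately show ?thesis using assms(1) by (simp add: even_sum_iff)
qed

text \<open>The combinatorial core, free of groups. In the application \<open>P\<close>,
  \<open>I\<close>, \<open>J\<close>, \<open>K\<close> are the sets of orbits of the fiber product,
  of its two factors and of the base, and the four maps send an orbit to its image.\<close>

lemma amalgam_sum:
  fixes p :: "'p \<Rightarrow> 'i" and q :: "'p \<Rightarrow> 'j" and u :: "'i \<Rightarrow> 'k" and v :: "'j \<Rightarrow> 'k"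
  assumes fin: "finite P" "finite I" "finite J"
    and p: "p ` P \<subseteq> I" and q: "q ` P \<subseteq> J" and u: "u ` I = K" and v: "v ` J = K"
    and comm: "\<And>z. z \<in> P \<Longrightarrow> u (p z) = v (q z)"
    and odd: "\<And>i j. i \<in> I \<Longrightarrow> j \<in> J \<Longrightarrow> u i = v j \<Longrightarrow> odd (card {z\<in>P. p z = i \<and> q z = j})"
  shows "(\<Sum>Z | Z \<subseteq> P \<and> p ` Z = I \<and> q ` Z = J. (- 2 :: int) ^ card Z) =
         (- 2) ^ (card I - card K) * (- 2) ^ card J"
proof -
  \<comment> \<open>Relaxing \<open>p\<close> onto \<open>I\<close> to \<open>p\<close> into
    \<open>A\<close> leaves only the surjectivity condition onto \<open>J\<close>, which can be
    tested fibre by fibre over \<open>J\<close>. The exact sums \<open>?f\<close> are recovered by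
    inversion.\<close>
  let ?F = "\<lambda>A. \<Sum>Z | Z \<subseteq> P \<and> p ` Z \<subseteq> A \<and> q ` Z = J. (- 2 :: int) ^ card Z"
  let ?f = "\<lambda>A. \<Sum>Z | Z \<subseteq> P \<and> p ` Z = A \<and> q ` Z = J. (- 2 :: int) ^ card Z"
  let ?good = "\<lambda>A. \<forall>k\<in>K. odd (card {i\<in>A. u i = k})"
  have finK: "finite K" using fin u by auto
  have F: "?F A = (if ?good A then (- 2) ^ card J else 0)" if A: "A \<subseteq> I" for A
  proof -
    let ?Q = "{z\<in>P. p z \<in> A}"
    have finA: "finite A" using A fin finite_subset by auto
    have fib: "odd (card {z\<in>?Q. q z = j}) \<longleftrightarrow> odd (card {i\<in>A. u i = v j})" if j: "j \<in> J" for j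
    proof (rule odd_card_fibres[where p = p])
      fix i assume i: "i \<in> {i\<in>A. u i = v j}"
      then have "{z \<in> {z\<in>?Q. q z = j}. p z = i} = {z\<in>P. p z = i \<and> q z = j}" by auto
      then show "odd (card {z \<in> {z\<in>?Q. q z = j}. p z = i})" using odd i j A by auto
    qed (use fin finA comm in auto)
    have "{Z. Z \<subseteq> P \<and> p ` Z \<subseteq> A \<and> q ` Z = J} = {Z. Z \<subseteq> ?Q \<and> (\<forall>j\<in>J. {z\<in>Z. q z = j} \<noteq> {})}"
      using q by auto
    moreover have "finite ?Q" "q ` ?Q \<subseteq> J" using fin q by auto
    ultimately have "?F A = (\<Prod>j\<in>J. \<Sum>S | S \<subseteq> {z\<in>?Q. q z = j} \<and> S \<noteq> {}. (- 2) ^ card S)"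
      using sum_fibrewise_power_card[where Q = ?Q and J = J and q = q and R = "\<lambda>S. S \<noteq> {}" and c = "- 2 :: int"] fin(3) by simp
    also have "\<dots> = (\<Prod>j\<in>J. if odd (card {i\<in>A. u i = v j}) then - 2 else 0)"
      by (rule prod.cong) (use fin fib in \<open>auto simp: sum_nonempty_subsets\<close>)
    \<comment> \<open>Since \<open>v\<close> maps onto \<open>K\<close>, no factor over
      \<open>J\<close> vanishes exactly when \<open>A\<close> has an odd number of elements over
      each \<open>k\<close> in \<open>K\<close>. Each factor is then -2.\<close>
    also have "\<dots> = (if ?good A then (- 2) ^ card J else 0)"
      using fin v by (auto simp: prod_zero_iff)
    finally show ?thesis .
  qed
  have "?f I = (\<Sum>A\<in>Pow I. (- 1) ^ (card I - card A) * ?F A)"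
  proof (rule inclusion_exclusion_mobius[OF _ fin(2)])
    \<comment> \<open>The inversion formula asks for this relation at every finite \<open>S\<close>.
      It is obtained by sorting the sets \<open>Z\<close> by their image under
      \<open>p\<close>.\<close>
    fix S :: "'i set" assume S: "finite S"
    have "sum ?f (Pow S) =
      (\<Sum>A\<in>Pow S. \<Sum>Z\<in>{Z \<in> {Z. Z \<subseteq> P \<and> p ` Z \<subseteq> S \<and> q ` Z = J}. p ` Z = A}. (- 2) ^ card Z)"
      by (intro sum.cong) auto
    also have "\<dots> = ?F S"
      by (rule sum.group) (use S fin in auto)
    finally show "?F S = sum ?f (Pow S)" by simp
  qed
  also have "\<dots> = (\<Sum>A\<in>Pow I. if ?good A then (- 1) ^ card I * (- 1) ^ card A * (- 2) ^ card J else 0)"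
  proof (rule sum.cong[OF refl])
    fix A assume A: "A \<in> Pow I"
    \<comment> \<open>Splitting the sign isolates \<open>(- 1) ^ card A\<close>, the part that
      factors over the fibres of \<open>u\<close>.\<close>
    then have "card A \<le> card I" using fin by (simp add: card_mono)
    then have "(- 1 :: int) ^ (card I - card A) = (- 1) ^ card I * (- 1) ^ card A"
      by (simp add: neg_one_power_add_eq_neg_one_power_diff flip: power_add)
    then show "(- 1) ^ (card I - card A) * ?F A =
        (if ?good A then (- 1) ^ card I * (- 1) ^ card A * (- 2) ^ card J else 0)"
      using F A by auto
  qed
  also have "\<dots> = (\<Sum>A | A \<subseteq> I \<and> ?good A. (- 1) ^ card I * (- 1) ^ card A * (- 2) ^ card J)"
    by (rule sum.mono_neutral_cong_right) (use fin in auto)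
  also have "\<dots> = (- 1) ^ card I * (\<Sum>A | A \<subseteq> I \<and> ?good A. (- 1) ^ card A) * (- 2) ^ card J"
    by (simp add: sum_distrib_left sum_distrib_right)
  also have "(\<Sum>A | A \<subseteq> I \<and> ?good A. (- 1 :: int) ^ card A) =
      (\<Prod>k\<in>K. \<Sum>S | S \<subseteq> {i\<in>I. u i = k} \<and> odd (card S). (- 1) ^ card S)"
    using sum_fibrewise_power_card[where Q = I and J = K and q = u and R = "\<lambda>S. odd (card S)" and c = "- 1 :: int"] fin finK u by simp
  also have "\<dots> = (\<Prod>k\<in>K. - (2 ^ (card {i\<in>I. u i = k} - 1)))"
    by (rule prod.cong[OF refl], rule sum_odd_subsets) (use fin u in auto)
  \<comment> \<open>The outer sign is distributed over the fibres of \<open>u\<close>. A fibre of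
    size n contributes (-1)^n * -(2^(n-1)) = (-2)^(n-1). As \<open>u\<close> is onto
    \<open>K\<close>, all fibres are nonempty and the exponents n - 1 add up to
    \<open>card I - card K\<close>.\<close>
  also have "(- 1) ^ card I * \<dots> = (- 2) ^ (card I - card K)"
  proof -
    have pos: "card {i\<in>I. u i = k} \<ge> 1" if "k \<in> K" for k
      using that u fin by (auto simp: Suc_le_eq card_gt_0_iff)
    have cI: "card I = (\<Sum>k\<in>K. card {i\<in>I. u i = k})"
      using sum.group[of I K u "\<lambda>_. 1::nat"] fin finK u by simp
    have "(- 1) ^ card I * (\<Prod>k\<in>K. - (2 ^ (card {i\<in>I. u i = k} - 1) :: int)) =
        (\<Prod>k\<in>K. (- 1) ^ card {i\<in>I. u i = k} * - (2 ^ (card {i\<in>I. u i = k} - 1)))"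
      by (simp add: cI power_sum flip: prod.distrib)
    also have "\<dots> = (\<Prod>k\<in>K. (- 2) ^ (card {i\<in>I. u i = k} - 1))"
    proof (rule prod.cong[OF refl])
      fix k assume "k \<in> K"
      then obtain n where "card {i\<in>I. u i = k} = Suc n" using pos[of k] by (cases "card {i\<in>I. u i = k}") auto
      then show "(- 1) ^ card {i\<in>I. u i = k} * - (2 ^ (card {i\<in>I. u i = k} - 1)) = (- 2 :: int) ^ (card {i\<in>I. u i = k} - 1)"
        by (simp add: power_minus[of 2])
    qed
    also have "\<dots> = (- 2) ^ (\<Sum>k\<in>K. card {i\<in>I. u i = k} - 1)" by (simp add: power_sum)
    also have "(\<Sum>k\<in>K. card {i\<in>I. u i = k} - 1) = card I - card K"
      using pos by (subst sum_subtractf_nat) (auto simp: cI)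
    finally show ?thesis .
  qed
  finally show ?thesis .
qed

section \<open>Orbits, products and copies of objects\<close>

lemma gorbits_eq: "gorbits G X = orbit G (act X) ` pts X"
  unfolding gorbits_def orbits_def by auto

lemma orbit_self: "is_gset G X \<Longrightarrow> x \<in> pts X \<Longrightarrow> x \<in> orbit G (act X) x"
  unfolding is_gset_def by (rule group_action.orbit_refl)

lemma orbit_subset: "is_gset G X \<Longrightarrow> x \<in> pts X \<Longrightarrow> orbit G (act X) x \<subseteq> pts X"
  unfolding orbit_def by (auto simp: gset_closed)

lemma orbit_actI: "g \<in> carrier G \<Longrightarrow> act X g x \<in> orbit G (act X) x"
  unfolding orbit_def by auto

lemma orbitE:
  assumes "y \<in> orbit G (act X) x"
  obtains g where "g \<in> carrier G" "y = act X g x"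
  using assms unfolding orbit_def by auto

lemma orbit_eqI:
  assumes X: "is_gset G X" "x \<in> pts X" and y: "y \<in> orbit G (act X) x"
  shows "orbit G (act X) y = orbit G (act X) x"
proof -
  interpret A: group_action G "pts X" "act X" using X by (simp add: is_gset_def)
  have yX: "y \<in> pts X" using y orbit_subset[OF X] by auto
  have xy: "x \<in> orbit G (act X) y" by (rule A.orbit_sym[OF X(2) yX y])
  show ?thesis
    using A.orbit_trans[OF X(2) yX _ y] A.orbit_trans[OF yX X(2) _ xy]
      orbit_subset[OF X] orbit_subset[OF X(1) yX] by blast
qed

lemma Union_gorbits: "is_gset G X \<Longrightarrow> \<Union> (gorbits G X) = pts X"
  unfolding gorbits_def is_gset_def by (rule group_action.orbits_coverture)

lemma gorbit_of:
  assumes X: "is_gset G X" and A: "A \<in> gorbits G X" "x \<in> A"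
  shows "x \<in> pts X \<and> A = orbit G (act X) x"
proof -
  obtain y where y: "y \<in> pts X" "A = orbit G (act X) y" using A by (auto simp: gorbits_eq)
  then show ?thesis using orbit_eqI[OF X y(1)] orbit_subset[OF X y(1)] A by blast
qed

lemma gorbit_nonempty:
  assumes X: "is_gset G X" and A: "A \<in> gorbits G X"
  shows "\<exists>x. x \<in> A"
proof -
  obtain y where y: "y \<in> pts X" "A = orbit G (act X) y" using A by (auto simp: gorbits_eq)
  then show ?thesis using orbit_self[OF X y(1)] by blast
qed

lemma gorbit_closed:
  assumes "is_gset G X" "A \<in> gorbits G X" "x \<in> A" "g \<in> carrier G"
  shows "act X g x \<in> A"
  using gorbit_of[OF assms(1-3)] orbit_actI[OF assms(4), of X x] by simp

lemma gmaps_orbit: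
  assumes "is_gset G X" "f \<in> gmaps G X Y" "x \<in> pts X"
  shows "f ` orbit G (act X) x = orbit G (act Y) (f x)"
  using gmaps_equi[OF assms(2) _ assms(3)] unfolding orbit_def by force

lemma gmaps_gorbits:
  assumes "is_gset G X" "f \<in> gmaps G X Y" "A \<in> gorbits G X"
  shows "f ` A \<in> gorbits G Y"
  using assms gmaps_orbit[OF assms(1,2)] gmaps_closed[OF assms(2)] unfolding gorbits_eq by auto

lemma gsurjs_gorbits:
  assumes "is_gset G X" "f \<in> gsurjs G X Y"
  shows "(`) f ` gorbits G X = gorbits G Y"
  using gmaps_orbit[OF assms(1) gsurjs_gmaps[OF assms(2)]] gsurjs_image[OF assms(2)]
  unfolding gorbits_eq by (simp add: image_image flip: gsurjs_image[OF assms(2)])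

lemma gsurjs_card:
  assumes "is_gset G X" "f \<in> gsurjs G X Y" "finite (gorbits G X)"
  shows "card (gorbits G Y) \<le> card (gorbits G X)"
  using gsurjs_gorbits[OF assms(1,2)] assms(3) card_image_le by metis

lemma giso_card:
  assumes "is_gset G X" "e \<in> gisos G X Y" "finite (gorbits G X)"
  shows "card (gorbits G X) = card (gorbits G Y)"
proof -
  have "inj_on ((`) e) (gorbits G X)"
  proof (rule inj_onI)
    fix A B assume "A \<in> gorbits G X" "B \<in> gorbits G X" "e ` A = e ` B"
    moreover from this have "A \<subseteq> pts X" "B \<subseteq> pts X" using Union_gorbits[OF assms(1)] by auto
    ultimately show "A = B" using gisosD(2)[OF assms(2)] by (simp add: inj_on_image_eq_iff)
  qed
  then show ?thesis
    using gsurjs_gorbits[OF assms(1) gisosD(4)[OF assms(2)]] card_image by metis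
qed

section \<open>Invariant subsets, products and fiber products\<close>

lemma sub_gset_simps [simp]:
  "pts (sub_gset X S) = S" "x \<in> S \<Longrightarrow> act (sub_gset X S) g x = act X g x"
  unfolding sub_gset_def by auto

lemma prod_gset_simps [simp]:
  "pts (prod_gset X Y) = pts X \<times> pts Y"
  "x \<in> pts X \<Longrightarrow> y \<in> pts Y \<Longrightarrow> act (prod_gset X Y) g (x, y) = (act X g x, act Y g y)"
  unfolding prod_gset_def by auto

lemma sub_gset_gset:
  assumes X: "is_gset G X" and S: "S \<subseteq> pts X" "\<And>g x. g \<in> carrier G \<Longrightarrow> x \<in> S \<Longrightarrow> act X g x \<in> S"
  shows "is_gset G (sub_gset X S)"
proof (rule is_gsetI[OF gset_group[OF X]])
  fix g x assume "g \<in> carrier G"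
  show "act (sub_gset X S) g \<in> extensional (pts (sub_gset X S))" by (simp add: sub_gset_def)
qed (use S in \<open>auto simp: gset_mult[OF X] gset_one[OF X] subset_iff\<close>)

lemma prod_gset_gset:
  assumes X: "is_gset G X" and Y: "is_gset G Y"
  shows "is_gset G (prod_gset X Y)"
proof (rule is_gsetI[OF gset_group[OF X]])
  fix g x assume "g \<in> carrier G"
  show "act (prod_gset X Y) g \<in> extensional (pts (prod_gset X Y))" by (simp add: prod_gset_def)
qed (auto simp: gset_mult[OF X] gset_one[OF X] gset_mult[OF Y] gset_one[OF Y] gset_closed[OF X] gset_closed[OF Y])

lemma sub_gset_orbit:
  assumes "x \<in> S"
  shows "orbit G (act (sub_gset X S)) x = orbit G (act X) x"
  using assms unfolding orbit_def by simp

lemma gorbits_sub: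
  assumes X: "is_gset G X" and S: "S \<subseteq> pts X" "\<And>g x. g \<in> carrier G \<Longrightarrow> x \<in> S \<Longrightarrow> act X g x \<in> S"
  shows "gorbits G (sub_gset X S) = {A \<in> gorbits G X. A \<subseteq> S}"
proof -
  have "orbit G (act X) x \<subseteq> S \<longleftrightarrow> x \<in> S" if "x \<in> pts X" for x
    using orbit_self[OF X that] S(2) unfolding orbit_def by auto
  then show ?thesis
    unfolding gorbits_eq using S(1) by (auto simp: sub_gset_orbit)
qed

lemma fiber_prod_pts [simp]:
  "pts (fiber_prod X f Y h) = {(x, y) \<in> pts X \<times> pts Y. f x = h y}"
  unfolding fiber_prod_def by simp

lemma fiber_prod_act [simp]:
  "x \<in> pts X \<Longrightarrow> y \<in> pts Y \<Longrightarrow> f x = h y \<Longrightarrow> act (fiber_prod X f Y h) g (x, y) = (act X g x, act Y g y)"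
  unfolding fiber_prod_def by simp

lemma fiber_prod_closed:
  assumes "is_gset G X" "is_gset G Y" "f \<in> gmaps G X Z" "h \<in> gmaps G Y Z"
    "g \<in> carrier G" "z \<in> {(x, y) \<in> pts X \<times> pts Y. f x = h y}"
  shows "act (prod_gset X Y) g z \<in> {(x, y) \<in> pts X \<times> pts Y. f x = h y}"
  using assms by (auto simp: gset_closed gmaps_equi)

lemma fiber_prod_gset:
  assumes "is_gset G X" "is_gset G Y" "f \<in> gmaps G X Z" "h \<in> gmaps G Y Z"
  shows "is_gset G (fiber_prod X f Y h)"
  unfolding fiber_prod_def
  by (rule sub_gset_gset[OF prod_gset_gset[OF assms(1,2)]]) (use fiber_prod_closed[OF assms] in auto)

section \<open>Closure properties of the category of smooth finitely generated sets\<close>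

lemma SG_gset: "X \<in> SG G T \<Longrightarrow> is_gset G X"
  unfolding SG_def by auto

lemma SG_finite: "X \<in> SG G T \<Longrightarrow> finite (gorbits G X)"
  unfolding SG_def by auto

lemma SG_sub:
  assumes "X \<in> SG G T" and S: "S \<subseteq> pts X" "\<And>g x. g \<in> carrier G \<Longrightarrow> x \<in> S \<Longrightarrow> act X g x \<in> S"
  shows "sub_gset X S \<in> SG G T"
proof -
  have "stabilizer G (act (sub_gset X S)) x = stabilizer G (act X) x" if "x \<in> S" for x
    using that unfolding stabilizer_def by simp
  then show ?thesis
    using assms sub_gset_gset[of G X S] gorbits_sub[of G X S] unfolding SG_def by auto
qed

lemma SG_iso:
  assumes Z: "is_gset G Z" and e: "e \<in> gisos G Z X" and X: "X \<in> SG G T"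
  shows "Z \<in> SG G T"
proof -
  have stab: "stabilizer G (act Z) z = stabilizer G (act X) (e z)" if z: "z \<in> pts Z" for z
  proof -
    have "act Z g z = z \<longleftrightarrow> act X g (e z) = e z" if g: "g \<in> carrier G" for g
      using gmaps_equi[OF gisosD(1)[OF e] g z] inj_on_eq_iff[OF gisosD(2)[OF e] gset_closed[OF Z g z] z] by simp
    then show ?thesis unfolding stabilizer_def by auto
  qed
  obtain h where h: "h \<in> gisos G X Z" using gisos_inv[OF Z e] by metis
  have "finite (gorbits G Z)"
    using gsurjs_gorbits[OF SG_gset[OF X] gisosD(4)[OF h]] SG_finite[OF X] by (metis finite_imageI)
  then show ?thesis
    using Z X stab gmaps_closed[OF gisosD(1)[OF e]] unfolding SG_def by auto
qed

text \<open>Stabilizers of pairs are intersections of two open stabilizers. For finiteness, fix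
  representatives \<open>x\<close> and \<open>y\<close> of an orbit in each factor: every orbit of
  pairs above them contains some (x, k y), and that orbit depends only on the double coset of
  \<open>k\<close> modulo the two stabilizers. Pro-oligomorphic groups have finitely many such
  double cosets.\<close>

lemma SG_prod:
  fixes X :: "('g, 'x) gset" and Y :: "('g, 'y) gset"
  assumes G: "pro_oligomorphic G T" and X: "X \<in> SG G T" and Y: "Y \<in> SG G T"
  shows "prod_gset X Y \<in> SG G T"
proof -
  let ?P = "prod_gset X Y"
  note gX = SG_gset[OF X] and gY = SG_gset[OF Y]
  have gP: "is_gset G ?P" by (rule prod_gset_gset[OF gX gY])
  interpret group G by (rule gset_group[OF gX])
  have "openin T (stabilizer G (act ?P) z)" if z: "z \<in> pts ?P" for z
  proof -
    have "stabilizer G (act ?P) z = stabilizer G (act X) (fst z) \<inter> stabilizer G (act Y) (snd z)"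
      using z unfolding stabilizer_def by auto
    then show ?thesis using z X Y unfolding SG_def by auto
  qed
  moreover have "finite (gorbits G ?P)"
  proof -
    define D where "D x y = {(stabilizer G (act X) x #>\<^bsub>G\<^esub> g) <#>\<^bsub>G\<^esub> stabilizer G (act Y) y | g. g \<in> carrier G}" for x y
    define xs where "xs A = (SOME x. x \<in> A)" for A :: "'x set"
    define ys where "ys A = (SOME x. x \<in> A)" for A :: "'y set"
    \<comment> \<open>The union over all elements of a double coset avoids choosing a
      representative. It will turn out to be a single orbit.\<close>
    let ?O = "\<lambda>(x, y) k. \<Union>g\<in>k. orbit G (act ?P) (x, act Y g y)"
    have finD: "finite (D x y)" if "x \<in> pts X" "y \<in> pts Y" for x y
    proof -
      have "open_subgroup G T (stabilizer G (act X) x)" "open_subgroup G T (stabilizer G (act Y) y)"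
        using that X Y gX gY unfolding open_subgroup_def SG_def is_gset_def
        by (auto intro: group_action.stabilizer_subgroup)
      then show ?thesis using G unfolding pro_oligomorphic_def D_def by blast
    qed
    have reps: "xs A \<in> pts X \<and> A = orbit G (act X) (xs A)" if "A \<in> gorbits G X" for A
      using gorbit_of[OF gX that] gorbit_nonempty[OF gX that] unfolding xs_def by (metis someI_ex)
    have reps': "ys A \<in> pts Y \<and> A = orbit G (act Y) (ys A)" if "A \<in> gorbits G Y" for A
      using gorbit_of[OF gY that] gorbit_nonempty[OF gY that] unfolding ys_def by (metis someI_ex)
    have "gorbits G ?P \<subseteq> (\<Union>A\<in>gorbits G X. \<Union>B\<in>gorbits G Y. ?O (xs A, ys B) ` D (xs A) (ys B))"
    proof
      fix C assume "C \<in> gorbits G ?P"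
      then obtain x1 y1 where xy1: "x1 \<in> pts X" "y1 \<in> pts Y" and C: "C = orbit G (act ?P) (x1, y1)"
        unfolding gorbits_eq by auto
      let ?A = "orbit G (act X) x1" and ?B = "orbit G (act Y) y1"
      have A: "?A \<in> gorbits G X" and B: "?B \<in> gorbits G Y" using xy1 by (auto simp: gorbits_eq)
      let ?x = "xs ?A" and ?y = "ys ?B"
      have x: "?x \<in> pts X" and y: "?y \<in> pts Y" using reps[OF A] reps'[OF B] by auto
      obtain a where a: "a \<in> carrier G" "x1 = act X a ?x"
        using reps[OF A] orbit_self[OF gX xy1(1)] orbitE by metis
      obtain b where b: "b \<in> carrier G" "y1 = act Y b ?y"
        using reps'[OF B] orbit_self[OF gY xy1(2)] orbitE by metis
      \<comment> \<open>The pair is (a x, b y). Acting by the inverse of \<open>a\<close> gives (x,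
        k y).\<close>
      define k where "k = inv\<^bsub>G\<^esub> a \<otimes>\<^bsub>G\<^esub> b"
      have k: "k \<in> carrier G" using a b by (simp add: k_def)
      let ?z = "(?x, act Y k ?y)"
      have z: "?z \<in> pts ?P" using x gset_closed[OF gY k y] by simp
      have "a \<otimes>\<^bsub>G\<^esub> k = b" using a b by (simp add: k_def flip: m_assoc)
      then have "act ?P a ?z = (x1, y1)"
        using x y a b k gset_closed[OF gY k y] by (simp flip: gset_mult[OF gY])
      then have "(x1, y1) \<in> orbit G (act ?P) ?z" using orbit_actI[OF a(1)] by metis
      then have Cz: "C = orbit G (act ?P) ?z" unfolding C by (rule orbit_eqI[OF gP z])
      let ?K = "(stabilizer G (act X) ?x #>\<^bsub>G\<^esub> k) <#>\<^bsub>G\<^esub> stabilizer G (act Y) ?y"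
      have sub: "orbit G (act ?P) (?x, act Y g ?y) = C" if gK: "g \<in> ?K" for g
      proof -
        obtain s t where s: "s \<in> carrier G" "act X s ?x = ?x" and t: "t \<in> carrier G" "act Y t ?y = ?y"
          and g: "g = s \<otimes>\<^bsub>G\<^esub> k \<otimes>\<^bsub>G\<^esub> t"
          using gK unfolding r_coset_def set_mult_def stabilizer_def by auto
        have "act Y g ?y = act Y s (act Y k ?y)"
          using s t k y by (simp add: g gset_mult[OF gY] gset_closed[OF gY])
        then have "(?x, act Y g ?y) = act ?P s ?z" using s x gset_closed[OF gY k y] by simp
        then have "(?x, act Y g ?y) \<in> orbit G (act ?P) ?z" using orbit_actI[OF s(1)] by metis
        then show ?thesis unfolding Cz by (rule orbit_eqI[OF gP z])
      qed
      have "\<one>\<^bsub>G\<^esub> \<otimes>\<^bsub>G\<^esub> k \<otimes>\<^bsub>G\<^esub> \<one>\<^bsub>G\<^esub> \<in> ?K"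
        unfolding r_coset_def set_mult_def stabilizer_def
        using gset_one[OF gX x] gset_one[OF gY y] by blast
      \<comment> \<open>The membership just shown makes the double coset nonempty, and all terms of
        the union equal \<open>C\<close> by \<open>sub\<close>.\<close>
      then have "?O (?x, ?y) ?K = C" using sub by auto
      moreover have "?K \<in> D ?x ?y" unfolding D_def using k by blast
      ultimately show "C \<in> (\<Union>A\<in>gorbits G X. \<Union>B\<in>gorbits G Y. ?O (xs A, ys B) ` D (xs A) (ys B))"
        using A B by blast
    qed
    moreover have "finite (\<Union>A\<in>gorbits G X. \<Union>B\<in>gorbits G Y. ?O (xs A, ys B) ` D (xs A) (ys B))"
      using SG_finite[OF X] SG_finite[OF Y] finD reps reps' by (intro finite_UN_I finite_imageI) auto
    ultimately show ?thesis by (rule finite_subset)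
  qed
  ultimately show ?thesis using gP unfolding SG_def by auto
qed

text \<open>A point is encoded by a number for its orbit and by the set of group elements that carry
  the representative of the orbit to it, which is a coset of a stabilizer. Carrying the action along
  this injection gives an isomorphic copy over the type \<open>nat \<times> 'g set\<close>, where
  the order lives.\<close>

lemma SG_copy:
  fixes X :: "('g, 'y) gset"
  assumes X: "X \<in> SG G T"
  obtains Z :: "('g, nat \<times> 'g set) gset" and e where "Z \<in> SG G T" "e \<in> gisos G Z X"
proof -
  note gX = SG_gset[OF X]
  obtain n :: "'y set \<Rightarrow> nat" where n: "inj_on n (gorbits G X)"
    using finite_imp_inj_to_nat_seg[OF SG_finite[OF X]] by metis
  define r where "r A = (SOME x. x \<in> A)" for A :: "'y set"
  have r: "r A \<in> A" if "A \<in> gorbits G X" for A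
    using gorbit_nonempty[OF gX that] unfolding r_def by (metis someI_ex)
  define \<iota> where "\<iota> x = (n (orbit G (act X) x), {g \<in> carrier G. act X g (r (orbit G (act X) x)) = x})" for x
  have inj: "inj_on \<iota> (pts X)"
  proof (rule inj_onI)
    fix x y assume x: "x \<in> pts X" and y: "y \<in> pts X" and eq: "\<iota> x = \<iota> y"
    have O: "orbit G (act X) x \<in> gorbits G X" "orbit G (act X) y \<in> gorbits G X"
      using x y by (auto simp: gorbits_eq)
    then have o: "orbit G (act X) x = orbit G (act X) y"
      using eq n unfolding \<iota>_def inj_on_def by blast
    have "x \<in> orbit G (act X) (r (orbit G (act X) x))"
      using gorbit_of[OF gX O(1) r[OF O(1)]] orbit_self[OF gX x] by simp
    then obtain g where "g \<in> carrier G" "x = act X g (r (orbit G (act X) x))" by (rule orbitE)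
    then show "x = y" using eq o unfolding \<iota>_def by auto
  qed
  define e where "e = restrict (inv_into (pts X) \<iota>) (\<iota> ` pts X)"
  define Z where "Z = \<lparr>pts = \<iota> ` pts X, act = (\<lambda>g. \<lambda>z\<in>\<iota> ` pts X. \<iota> (act X g (e z)))\<rparr>"
  have e: "e (\<iota> x) = x" if "x \<in> pts X" for x
    using that inj by (simp add: e_def)
  have Zact: "act Z g (\<iota> x) = \<iota> (act X g x)" if "x \<in> pts X" for g x
    using that by (simp add: Z_def e)
  have pZ: "pts Z = \<iota> ` pts X" by (simp add: Z_def)
  have gZ: "is_gset G Z"
  proof (rule is_gsetI[OF gset_group[OF gX]])
    fix g assume "g \<in> carrier G"
    show "act Z g \<in> extensional (pts Z)" by (simp add: Z_def)
  qed (auto simp: pZ Zact gset_closed[OF gX] gset_one[OF gX] gset_mult[OF gX])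
  have "e \<in> gmaps G Z X"
    unfolding gmaps_def by (auto simp: pZ Zact e gset_closed[OF gX]) (simp add: e_def)
  moreover have "inj_on e (pts Z)" by (simp add: pZ inj_on_def e)
  moreover have "pts X \<subseteq> e ` pts Z"
  proof
    fix x assume "x \<in> pts X"
    then show "x \<in> e ` pts Z" using e[of x] pZ by (metis imageI)
  qed
  ultimately have iso: "e \<in> gisos G Z X" by (rule gisosI)
  show thesis by (rule that[OF SG_iso[OF gZ iso X] iso])
qed

lemma is_orderD:
  assumes "is_order G T E"
  shows "E \<subseteq> SG G T" "point_gset p \<in> E"
    "X \<in> E \<Longrightarrow> Y \<in> E \<Longrightarrow> Z \<in> SG G T \<Longrightarrow> e \<in> gisos G Z (prod_gset X Y) \<Longrightarrow> Z \<in> E"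
    "X \<in> E \<Longrightarrow> Z \<in> SG G T \<Longrightarrow> m \<in> ginjs G Z X \<Longrightarrow> Z \<in> E"
proof -
  show "E \<subseteq> SG G T" "point_gset p \<in> E" using assms unfolding is_order_def by simp_all
  have "\<forall>X\<in>E. \<forall>Y\<in>E. \<forall>Z\<in>SG G T. giso G Z (prod_gset X Y) \<longrightarrow> Z \<in> E"
    using assms unfolding is_order_def by (elim conjE)
  then show "X \<in> E \<Longrightarrow> Y \<in> E \<Longrightarrow> Z \<in> SG G T \<Longrightarrow> e \<in> gisos G Z (prod_gset X Y) \<Longrightarrow> Z \<in> E"
    unfolding giso_def by blast
  have "\<forall>X\<in>E. \<forall>Z\<in>SG G T. ginjs G Z X \<noteq> {} \<longrightarrow> Z \<in> E"
    using assms unfolding is_order_def by (elim conjE)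
  then show "X \<in> E \<Longrightarrow> Z \<in> SG G T \<Longrightarrow> m \<in> ginjs G Z X \<Longrightarrow> Z \<in> E" by blast
qed

text \<open>The product and its subset have a pair type as underlying type and so cannot be members
  of \<open>E\<close> themselves. A copy \<open>Q\<close> of the product lies in \<open>E\<close> by
  closure under products; a copy \<open>Z\<close> of the subset embeds into \<open>Q\<close> and
  lies in \<open>E\<close> by closure under subobjects.\<close>

lemma order_prod_sub:
  fixes E :: "('g, nat \<times> 'g set) gset set"
  assumes G: "pro_oligomorphic G T" and E: "is_order G T E" and X: "X \<in> E" and Y: "Y \<in> E"
    and S: "S \<subseteq> pts X \<times> pts Y"
      "\<And>g z. g \<in> carrier G \<Longrightarrow> z \<in> S \<Longrightarrow> act (prod_gset X Y) g z \<in> S"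
  obtains Z e where "Z \<in> E" "e \<in> gisos G Z (sub_gset (prod_gset X Y) S)"
proof -
  have "X \<in> SG G T" "Y \<in> SG G T" using is_orderD(1)[OF E] X Y by auto
  then have P: "prod_gset X Y \<in> SG G T" by (rule SG_prod[OF G])
  obtain Q :: "('g, nat \<times> 'g set) gset" and q where Q: "Q \<in> SG G T" and q: "q \<in> gisos G Q (prod_gset X Y)"
    by (rule SG_copy[OF P])
  have QE: "Q \<in> E" by (rule is_orderD(3)[OF E X Y Q q])
  have PS: "sub_gset (prod_gset X Y) S \<in> SG G T"
    by (rule SG_sub[OF P]) (use S in auto)
  obtain Z :: "('g, nat \<times> 'g set) gset" and e where Z: "Z \<in> SG G T" and e: "e \<in> gisos G Z (sub_gset (prod_gset X Y) S)"
    by (rule SG_copy[OF PS])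
  obtain h where h: "h \<in> gisos G (prod_gset X Y) Q" using gisos_inv[OF SG_gset[OF Q] q] by metis
  have eS: "e z \<in> S" if "z \<in> pts Z" for z
    using gmaps_closed[OF gisosD(1)[OF e] that] by simp
  then have "\<forall>z\<in>pts Z. e z \<in> pts X \<times> pts Y" using S(1) by blast
  then have eP: "e \<in> gmaps G Z (prod_gset X Y)"
    using gisosD(1)[OF e] eS unfolding gmaps_def by (simp add: PiE_iff)
  have eg: "e \<in> ginjs G Z (prod_gset X Y)"
    using eP gisosD(2)[OF e] unfolding ginjs_def by simp
  have hi: "h \<in> ginjs G (prod_gset X Y) Q" using h unfolding gisos_def ginjs_def bij_betw_def by auto
  have he: "compose (pts Z) h e \<in> ginjs G Z Q"
  proof -
    have "e ` pts Z \<subseteq> pts (prod_gset X Y)" by (rule image_subsetI) (rule gmaps_closed[OF eP])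
    then have "inj_on h (e ` pts Z)" using hi inj_on_subset unfolding ginjs_def by blast
    then have "inj_on (compose (pts Z) h e) (pts Z)"
      using eg unfolding ginjs_def by (auto simp: inj_on_def compose_eq)
    then show ?thesis
      using gmaps_compose[OF SG_gset[OF Z], of e _ h] eg hi unfolding ginjs_def by auto
  qed
  show thesis by (rule that[OF is_orderD(4)[OF E QE Z he] e])
qed

section \<open>Amalgams in an order\<close>

text \<open>Composing \<open>v\<close> with any section of \<open>u\<close> gives \<open>f\<close>.
  The section itself need not be equivariant, but by \<open>eq\<close> its choice does not affect
  the values, and equivariance descends from \<open>W\<close>.\<close>

lemma gsurjs_factor:
  assumes W: "is_gset G W" and u: "u \<in> gsurjs G W Y" and v: "v \<in> gsurjs G W X"
    and eq: "\<And>w w'. w \<in> pts W \<Longrightarrow> w' \<in> pts W \<Longrightarrow> u w = u w' \<Longrightarrow> v w = v w'"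
  obtains f where "f \<in> gsurjs G Y X" "v = compose (pts W) f u"
proof -
  define f where "f = (\<lambda>y\<in>pts Y. v (inv_into (pts W) u y))"
  have uY: "u w \<in> pts Y" if "w \<in> pts W" for w using gmaps_closed[OF gsurjs_gmaps[OF u] that] .
  have fu: "f (u w) = v w" if w: "w \<in> pts W" for w
  proof -
    have uw: "u w \<in> u ` pts W" using w by simp
    have "v (inv_into (pts W) u (u w)) = v w"
      by (rule eq[OF inv_into_into[OF uw] w f_inv_into_f[OF uw]])
    then show ?thesis using uY[OF w] by (simp add: f_def)
  qed
  have "f y \<in> pts X" "\<And>g. g \<in> carrier G \<Longrightarrow> f (act Y g y) = act X g (f y)" if y: "y \<in> pts Y" for y
  proof -
    obtain w where w: "w \<in> pts W" "y = u w" using y gsurjs_image[OF u] by blast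
    then show "f y \<in> pts X" using fu gmaps_closed[OF gsurjs_gmaps[OF v] w(1)] by simp
    fix g assume g: "g \<in> carrier G"
    show "f (act Y g y) = act X g (f y)"
      using fu[OF gset_closed[OF W g w(1)]] fu[OF w(1)] w(2)
        gmaps_equi[OF gsurjs_gmaps[OF u] g w(1)] gmaps_equi[OF gsurjs_gmaps[OF v] g w(1)] by simp
  qed
  then have "f \<in> gmaps G Y X" unfolding gmaps_def by (simp add: PiE_iff f_def)
  moreover have "f ` pts Y = pts X"
    using fu by (simp add: image_image flip: gsurjs_image[OF u] gsurjs_image[OF v])
  ultimately have "f \<in> gsurjs G Y X" unfolding gsurjs_def by simp
  moreover have "v = compose (pts W) f u"
    using fu gmaps_ext[OF gsurjs_gmaps[OF v]]
    by (auto simp: compose_def fun_eq_iff restrict_def extensional_def)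
  ultimately show thesis by (rule that)
qed

lemma fiber_prod_fst:
  assumes "is_gset G Y" "is_gset G J" "f \<in> gmaps G Y X" "h \<in> gmaps G J X"
  shows "(\<lambda>z\<in>pts (fiber_prod Y f J h). fst z) \<in> gmaps G (fiber_prod Y f J h) Y"
  unfolding gmaps_def[of G "fiber_prod Y f J h"]
  using assms by (auto simp: gset_closed gmaps_equi)

lemma fiber_prod_snd:
  assumes "is_gset G Y" "is_gset G J" "f \<in> gmaps G Y X" "h \<in> gmaps G J X"
  shows "(\<lambda>z\<in>pts (fiber_prod Y f J h). snd z) \<in> gmaps G (fiber_prod Y f J h) J"
  unfolding gmaps_def[of G "fiber_prod Y f J h"]
  using assms by (auto simp: gset_closed gmaps_equi)

locale order_gset =
  fixes G :: "('g, 'm) monoid_scheme" and T :: "'g topology"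
    and E :: "('g, nat \<times> 'g set) gset set"
  assumes olig: "pro_oligomorphic G T" and order: "is_order G T E"
begin

lemma objs_SG: "X \<in> nonempty_objs E \<Longrightarrow> X \<in> SG G T"
  using is_orderD(1)[OF order] unfolding nonempty_objs_def by auto

lemma objs_gset: "X \<in> nonempty_objs E \<Longrightarrow> is_gset G X"
  using objs_SG SG_gset by auto

lemma objs_finite: "X \<in> nonempty_objs E \<Longrightarrow> finite (gorbits G X)"
  using objs_SG SG_finite by auto

text \<open>Replaces an invariant set of pairs by an object of \<open>E\<close> with two jointly
  injective projections. It serves twice: for the kernel pair of a surjection in
  \<open>map_from_surj\<close>, and for unions of orbits of a fiber product in
  \<open>amalg_object\<close>. The two image conditions on \<open>S\<close> make the projections
  surjective.\<close>

lemma objs_prod_sub: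
  assumes X: "X \<in> nonempty_objs E" and Y: "Y \<in> nonempty_objs E"
    and S: "S \<subseteq> pts X \<times> pts Y"
      "\<And>g z. g \<in> carrier G \<Longrightarrow> z \<in> S \<Longrightarrow> act (prod_gset X Y) g z \<in> S"
      "fst ` S = pts X" "snd ` S = pts Y"
  obtains Z p q where "Z \<in> nonempty_objs E" "p \<in> gsurjs G Z X" "q \<in> gsurjs G Z Y"
    "bij_betw (\<lambda>z. (p z, q z)) (pts Z) S"
    "card (gorbits G Z) = card {A \<in> gorbits G (prod_gset X Y). A \<subseteq> S}"
proof -
  let ?P = "prod_gset X Y"
  have gP: "is_gset G ?P" by (rule prod_gset_gset[OF objs_gset[OF X] objs_gset[OF Y]])
  obtain Z e where Z: "Z \<in> E" and e: "e \<in> gisos G Z (sub_gset ?P S)"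
    using order_prod_sub[OF olig order _ _ S(1,2)] X Y unfolding nonempty_objs_def by blast
  have ZSG: "Z \<in> SG G T" using Z is_orderD(1)[OF order] by auto
  note gZ = SG_gset[OF ZSG]
  define p where "p = (\<lambda>z\<in>pts Z. fst (e z))"
  define q where "q = (\<lambda>z\<in>pts Z. snd (e z))"
  have eS: "e z \<in> S" if "z \<in> pts Z" for z using gmaps_closed[OF gisosD(1)[OF e] that] by simp
  have mem: "fst (e z) \<in> pts X" "snd (e z) \<in> pts Y" if "z \<in> pts Z" for z
    using eS[OF that] S(1) by auto
  have act: "e (act Z g z) = (act X g (fst (e z)), act Y g (snd (e z)))"
    if "g \<in> carrier G" "z \<in> pts Z" for g z
  proof -
    have "e (act Z g z) = act ?P g (e z)"
      using gmaps_equi[OF gisosD(1)[OF e] that] eS[OF that(2)] by simp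
    also have "\<dots> = act ?P g (fst (e z), snd (e z))" by simp
    finally show ?thesis using mem[OF that(2)] by (simp del: prod.collapse)
  qed
  have im: "e ` pts Z = S" using gisosD(3)[OF e] by simp
  have "p \<in> gmaps G Z X" "q \<in> gmaps G Z Y"
    unfolding gmaps_def p_def q_def by (auto simp: mem act gset_closed[OF gZ])
  moreover have "p ` pts Z = pts X" "q ` pts Z = pts Y"
    using S(3,4) by (simp_all add: p_def q_def image_image flip: im)
  ultimately have pq: "p \<in> gsurjs G Z X" "q \<in> gsurjs G Z Y" unfolding gsurjs_def by auto
  have bij: "bij_betw (\<lambda>z. (p z, q z)) (pts Z) S"
  proof -
    have "bij_betw e (pts Z) S" using e by (simp add: gisos_def)
    then show ?thesis by (subst bij_betw_cong[of _ _ e]) (simp_all add: p_def q_def)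
  qed
  have ne: "Z \<in> nonempty_objs E"
    using Z X pq(1) gsurjs_image[OF pq(1)] unfolding nonempty_objs_def by auto
  have "card (gorbits G Z) = card {A \<in> gorbits G ?P. A \<subseteq> S}"
    using giso_card[OF gZ e SG_finite[OF ZSG]] gorbits_sub[OF gP _ S(2)] S(1) by simp
  then show thesis by (rule that[OF ne pq bij])
qed

text \<open>Oddness speaks of atoms only. This makes it applicable to the single orbits of arbitrary
  objects.\<close>

lemma gorbit_atom:
  assumes X: "X \<in> nonempty_objs E" and A: "A \<in> gorbits G X"
  shows "sub_gset X A \<in> atoms G E"
proof -
  note gX = objs_gset[OF X]
  have AX: "A \<subseteq> pts X" and cl: "\<And>g x. g \<in> carrier G \<Longrightarrow> x \<in> A \<Longrightarrow> act X g x \<in> A"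
    using gorbit_of[OF gX A] gorbit_closed[OF gX A] by auto
  have sg: "sub_gset X A \<in> SG G T" by (rule SG_sub[OF objs_SG[OF X] AX cl])
  have "(\<lambda>x\<in>A. x) \<in> ginjs G (sub_gset X A) X"
    using AX cl unfolding ginjs_def gmaps_def by (auto simp: inj_on_def)
  then have "sub_gset X A \<in> E"
    using is_orderD(4)[OF order _ sg] X unfolding nonempty_objs_def by blast
  moreover have "transitive_action G (pts (sub_gset X A)) (act (sub_gset X A))"
    unfolding transitive_action_def transitive_action_axioms_def
  proof (intro conjI allI impI)
    show "group_action G (pts (sub_gset X A)) (act (sub_gset X A))"
      using SG_gset[OF sg] unfolding is_gset_def .
    fix x y assume "x \<in> pts (sub_gset X A)" "y \<in> pts (sub_gset X A)"
    then have xy: "x \<in> A" "y \<in> A" by auto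
    then have "y \<in> orbit G (act X) x" using gorbit_of[OF gX A xy(1)] by simp
    then obtain g where "g \<in> carrier G" "y = act X g x" by (rule orbitE)
    then show "\<exists>g\<in>carrier G. act (sub_gset X A) g x = y" using xy by auto
  qed
  moreover have "A \<noteq> {}" using gorbit_nonempty[OF gX A] by auto
  ultimately show ?thesis unfolding atoms_def by simp
qed

section \<open>Amalgams of two surjections with a common target\<close>

context
  fixes X Y J f h
  assumes X: "X \<in> nonempty_objs E" and Y: "Y \<in> nonempty_objs E" and J: "J \<in> nonempty_objs E"
    and f: "f \<in> gsurjs G Y X" and h: "h \<in> gsurjs G J X"
begin

text \<open>An amalgam is a subobject of the fiber product that surjects onto both factors. It is
  recorded as its set of orbits, so its \<open>card\<close> is the rank and
  \<open>amalgam_sum\<close> applies literally.\<close>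

definition amalgs :: "((nat \<times> 'g set) \<times> (nat \<times> 'g set)) set set set" where
  "amalgs = {ZZ. ZZ \<subseteq> gorbits G (fiber_prod Y f J h) \<and>
     (`) fst ` ZZ = gorbits G Y \<and> (`) snd ` ZZ = gorbits G J}"

private abbreviation "F \<equiv> fiber_prod Y f J h"

lemma fp_gset: "is_gset G F"
  by (rule fiber_prod_gset[OF objs_gset[OF Y] objs_gset[OF J] gsurjs_gmaps[OF f] gsurjs_gmaps[OF h]])

lemma fp_orbit_fst:
  assumes z: "z \<in> pts F"
  shows "fst ` orbit G (act F) z = orbit G (act Y) (fst z)"
proof -
  have "fst ` orbit G (act F) z = (\<lambda>z\<in>pts F. fst z) ` orbit G (act F) z"
  proof (rule image_cong[OF refl])
    fix a assume "a \<in> orbit G (act F) z"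
    then have "a \<in> pts F" by (rule subsetD[OF orbit_subset[OF fp_gset z]])
    then show "fst a = (\<lambda>z\<in>pts F. fst z) a" by (simp del: fiber_prod_pts)
  qed
  also have "\<dots> = orbit G (act Y) ((\<lambda>z\<in>pts F. fst z) z)"
    by (rule gmaps_orbit[OF fp_gset fiber_prod_fst[OF objs_gset[OF Y] objs_gset[OF J]
          gsurjs_gmaps[OF f] gsurjs_gmaps[OF h]] z])
  also have "(\<lambda>z\<in>pts F. fst z) z = fst z" using z by (rule restrict_apply')
  finally show ?thesis .
qed

lemma fp_orbit_snd:
  assumes z: "z \<in> pts F"
  shows "snd ` orbit G (act F) z = orbit G (act J) (snd z)"
proof -
  have "snd ` orbit G (act F) z = (\<lambda>z\<in>pts F. snd z) ` orbit G (act F) z"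
  proof (rule image_cong[OF refl])
    fix a assume "a \<in> orbit G (act F) z"
    then have "a \<in> pts F" by (rule subsetD[OF orbit_subset[OF fp_gset z]])
    then show "snd a = (\<lambda>z\<in>pts F. snd z) a" by (simp del: fiber_prod_pts)
  qed
  also have "\<dots> = orbit G (act J) ((\<lambda>z\<in>pts F. snd z) z)"
    by (rule gmaps_orbit[OF fp_gset fiber_prod_snd[OF objs_gset[OF Y] objs_gset[OF J]
          gsurjs_gmaps[OF f] gsurjs_gmaps[OF h]] z])
  also have "(\<lambda>z\<in>pts F. snd z) z = snd z" using z by (rule restrict_apply')
  finally show ?thesis .
qed

lemma fp_gorbits: "gorbits G F = {A \<in> gorbits G (prod_gset Y J). A \<subseteq> pts F}"
  unfolding fiber_prod_def
  by (subst gorbits_sub[OF prod_gset_gset[OF objs_gset[OF Y] objs_gset[OF J]]])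
     (use fiber_prod_closed[OF objs_gset[OF Y] objs_gset[OF J] gsurjs_gmaps[OF f] gsurjs_gmaps[OF h]] in auto)

lemma fp_finite: "finite (gorbits G F)"
  unfolding fp_gorbits using SG_finite[OF SG_prod[OF olig objs_SG[OF Y] objs_SG[OF J]]] by simp

lemma amalg_object:
  assumes ZZ: "ZZ \<in> amalgs"
  obtains Z p q where "Z \<in> nonempty_objs E" "p \<in> gsurjs G Z Y" "q \<in> gsurjs G Z J"
    "bij_betw (\<lambda>z. (p z, q z)) (pts Z) (\<Union>ZZ)" "card (gorbits G Z) = card ZZ"
proof -
  let ?P = "prod_gset Y J"
  have gP: "is_gset G ?P" by (rule prod_gset_gset[OF objs_gset[OF Y] objs_gset[OF J]])
  have sub: "ZZ \<subseteq> gorbits G ?P" using ZZ unfolding amalgs_def fp_gorbits by auto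
  have S1: "\<Union>ZZ \<subseteq> pts Y \<times> pts J" using sub Union_gorbits[OF gP] by auto
  have S2: "act ?P g z \<in> \<Union>ZZ" if "g \<in> carrier G" "z \<in> \<Union>ZZ" for g z
    using that sub gorbit_closed[OF gP _ _ that(1), of _ z] by blast
  have "fst ` \<Union>ZZ = \<Union>((`) fst ` ZZ)" "snd ` \<Union>ZZ = \<Union>((`) snd ` ZZ)" by auto
  then have S3: "fst ` \<Union>ZZ = pts Y" "snd ` \<Union>ZZ = pts J"
    using ZZ Union_gorbits[OF objs_gset[OF Y]] Union_gorbits[OF objs_gset[OF J]] unfolding amalgs_def by auto
  \<comment> \<open>Orbits are disjoint, so the union of \<open>ZZ\<close> contains no orbit outside
    \<open>ZZ\<close>. This identifies the orbit count of \<open>Z\<close> with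
    \<open>card ZZ\<close>.\<close>
  have eq: "{A \<in> gorbits G ?P. A \<subseteq> \<Union>ZZ} = ZZ"
  proof (intro equalityI subsetI)
    fix A assume "A \<in> {A \<in> gorbits G ?P. A \<subseteq> \<Union>ZZ}"
    then have A: "A \<in> gorbits G ?P" "A \<subseteq> \<Union>ZZ" by auto
    obtain x where x: "x \<in> A" using gorbit_nonempty[OF gP A(1)] by auto
    then obtain C where C: "C \<in> ZZ" "x \<in> C" using A(2) by auto
    then have CP: "C \<in> gorbits G ?P" using sub by auto
    have "A = C" using gorbit_of[OF gP A(1) x] gorbit_of[OF gP CP C(2)] by simp
    then show "A \<in> ZZ" using C by simp
  qed (use sub in auto)
  obtain Z p q where Z: "Z \<in> nonempty_objs E" "p \<in> gsurjs G Z Y" "q \<in> gsurjs G Z J"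
    "bij_betw (\<lambda>z. (p z, q z)) (pts Z) (\<Union>ZZ)"
    "card (gorbits G Z) = card {A \<in> gorbits G ?P. A \<subseteq> \<Union>ZZ}"
    by (rule objs_prod_sub[OF Y J S1 S2 S3])
  show thesis by (rule that[OF Z(1-4) Z(5)[unfolded eq]])
qed

text \<open>The image of \<open>W\<close> in the fiber product is invariant, hence a union of
  orbits, and it projects onto both factors because \<open>u\<close> and \<open>v\<close> are onto.
  This is how a pair of germs over the same germ of \<open>X\<close> finds its amalgam.\<close>

lemma amalg_of_maps:
  assumes W: "is_gset G W" and u: "u \<in> gsurjs G W Y" and v: "v \<in> gsurjs G W J"
    and eq: "\<And>w. w \<in> pts W \<Longrightarrow> f (u w) = h (v w)"
  obtains ZZ where "ZZ \<in> amalgs" "(\<lambda>w. (u w, v w)) ` pts W = \<Union>ZZ"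
proof -
  define S where "S = (\<lambda>w. (u w, v w)) ` pts W"
  have SF: "S \<subseteq> pts F"
    using eq gmaps_closed[OF gsurjs_gmaps[OF u]] gmaps_closed[OF gsurjs_gmaps[OF v]]
    unfolding S_def by auto
  have cl: "act F g z \<in> S" if g: "g \<in> carrier G" and z: "z \<in> S" for g z
  proof -
    obtain w where w: "w \<in> pts W" "z = (u w, v w)" using z unfolding S_def by auto
    have "act F g z = (u (act W g w), v (act W g w))"
      using SF z w(2) gmaps_equi[OF gsurjs_gmaps[OF u] g w(1)] gmaps_equi[OF gsurjs_gmaps[OF v] g w(1)]
      by auto
    then show ?thesis using gset_closed[OF W g w(1)] unfolding S_def by auto
  qed
  define ZZ where "ZZ = {A \<in> gorbits G F. A \<subseteq> S}"
  have orb: "orbit G (act F) z \<in> ZZ" if z: "z \<in> S" for z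
  proof -
    have "orbit G (act F) z \<subseteq> S" using cl[OF _ z] unfolding orbit_def by blast
    then show ?thesis using z SF unfolding ZZ_def gorbits_eq by blast
  qed
  have U: "\<Union>ZZ = S"
  proof (intro equalityI subsetI)
    fix z assume z: "z \<in> S"
    then have "z \<in> orbit G (act F) z" using orbit_self[OF fp_gset] SF by auto
    then show "z \<in> \<Union>ZZ" using orb[OF z] by auto
  qed (auto simp: ZZ_def)
  have rep: "\<exists>z\<in>S. A = orbit G (act F) z" if "A \<in> ZZ" for A
  proof -
    have A: "A \<in> gorbits G F" "A \<subseteq> S" using that unfolding ZZ_def by auto
    obtain z where z: "z \<in> A" using gorbit_nonempty[OF fp_gset A(1)] by auto
    show ?thesis using gorbit_of[OF fp_gset A(1) z] z A(2) by blast
  qed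
  have ZZeq: "ZZ = orbit G (act F) ` S" using rep orb by blast
  have "(`) fst ` ZZ = (\<lambda>z. orbit G (act Y) (fst z)) ` S"
    unfolding ZZeq image_image by (rule image_cong[OF refl]) (use SF fp_orbit_fst in blast)
  also have "\<dots> = (\<lambda>w. orbit G (act Y) (u w)) ` pts W" unfolding S_def image_image by simp
  also have "\<dots> = gorbits G Y" unfolding gorbits_eq by (simp add: image_image flip: gsurjs_image[OF u])
  finally have 1: "(`) fst ` ZZ = gorbits G Y" .
  have "(`) snd ` ZZ = (\<lambda>z. orbit G (act J) (snd z)) ` S"
    unfolding ZZeq image_image by (rule image_cong[OF refl]) (use SF fp_orbit_snd in blast)
  also have "\<dots> = (\<lambda>w. orbit G (act J) (v w)) ` pts W" unfolding S_def image_image by simp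
  also have "\<dots> = gorbits G J" unfolding gorbits_eq by (simp add: image_image flip: gsurjs_image[OF v])
  finally have 2: "(`) snd ` ZZ = gorbits G J" .
  have "ZZ \<in> amalgs" unfolding amalgs_def using 1 2 by (auto simp: ZZ_def)
  then show thesis by (rule that) (simp add: U flip: S_def)
qed

lemma amalgs_sum:
  assumes odd: "odd_order G E"
  shows "(\<Sum>ZZ\<in>amalgs. (- 2 :: int) ^ card ZZ) =
    (- 2) ^ (card (gorbits G Y) - card (gorbits G X)) * (- 2) ^ card (gorbits G J)"
  unfolding amalgs_def
proof (rule amalgam_sum[where u = "(`) f" and v = "(`) h"])
  show "finite (gorbits G F)" by (rule fp_finite)
  show "finite (gorbits G Y)" "finite (gorbits G J)" using objs_finite Y J by auto
  have orb: "fst ` A \<in> gorbits G Y \<and> snd ` A \<in> gorbits G J \<and> f ` fst ` A = h ` snd ` A"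
    if A: "A \<in> gorbits G F" for A
  proof -
    obtain z where z: "z \<in> pts F" "A = orbit G (act F) z" using A unfolding gorbits_eq by auto
    have "A \<subseteq> pts F" using orbit_subset[OF fp_gset z(1)] z(2) by simp
    then have "f (fst a) = h (snd a)" if "a \<in> A" for a using that by auto
    then have "f ` fst ` A = h ` snd ` A" unfolding image_image by (rule image_cong[OF refl])
    then show ?thesis
      using fp_orbit_fst[OF z(1)] fp_orbit_snd[OF z(1)] z unfolding gorbits_eq by auto
  qed
  then show "(`) fst ` gorbits G F \<subseteq> gorbits G Y" "(`) snd ` gorbits G F \<subseteq> gorbits G J" by auto
  show "f ` fst ` A = h ` snd ` A" if "A \<in> gorbits G F" for A using orb[OF that] by simp
  show "(`) f ` gorbits G Y = gorbits G X" "(`) h ` gorbits G J = gorbits G X"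
    using gsurjs_gorbits objs_gset Y J f h by blast+
  fix A B assume A: "A \<in> gorbits G Y" and B: "B \<in> gorbits G J" and AB: "f ` A = h ` B"
  have C: "f ` A \<in> gorbits G X" by (rule gmaps_gorbits[OF objs_gset[OF Y] gsurjs_gmaps[OF f] A])
  have sub: "A \<subseteq> pts Y" "B \<subseteq> pts J"
    using A B Union_gorbits[OF objs_gset[OF Y]] Union_gorbits[OF objs_gset[OF J]] by auto
  \<comment> \<open>Oddness is applied to \<open>f\<close> and \<open>h\<close> cut down to the
    orbits \<open>A\<close> and \<open>B\<close>, both of which map onto one orbit of
    \<open>X\<close>. The orbits of this smaller fiber product are the orbits of the large one that
    project onto \<open>A\<close> and \<open>B\<close>.\<close>
  let ?f = "restrict f A" and ?h = "restrict h B"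
  let ?F = "fiber_prod (sub_gset Y A) ?f (sub_gset J B) ?h"
  have fm: "?f \<in> gmaps G (sub_gset Y A) (sub_gset X (f ` A))"
    using gmaps_equi[OF gsurjs_gmaps[OF f]] gorbit_closed[OF objs_gset[OF Y] A] sub(1)
    unfolding gmaps_def by auto
  have hm: "?h \<in> gmaps G (sub_gset J B) (sub_gset X (f ` A))"
    using gmaps_equi[OF gsurjs_gmaps[OF h]] gorbit_closed[OF objs_gset[OF J] B] sub(2)
    unfolding gmaps_def AB by auto
  have "odd (card (gorbits G ?F))"
    using odd gorbit_atom[OF X C] gorbit_atom[OF Y A] gorbit_atom[OF J B] fm hm
    unfolding odd_order_def by blast
  also have "gorbits G ?F = {z \<in> gorbits G F. fst ` z = A \<and> snd ` z = B}"
  proof -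
    have o: "orbit G (act ?F) z = orbit G (act F) z" if zF: "z \<in> pts ?F" for z
    proof -
      obtain x y where z: "z = (x, y)" by (cases z)
      then have A: "x \<in> A" and B: "y \<in> B" and eq: "f x = h y" using zF by auto
      have "x \<in> pts Y" "y \<in> pts J" using A B sub by auto
      then have "act ?F g z = act F g z" for g unfolding z using A B eq by simp
      then show ?thesis unfolding orbit_def by simp
    qed
    have pF: "pts ?F = {z \<in> pts F. fst z \<in> A \<and> snd z \<in> B}" using sub by auto
    have iff: "fst z \<in> A \<longleftrightarrow> fst ` orbit G (act F) z = A" "snd z \<in> B \<longleftrightarrow> snd ` orbit G (act F) z = B"
      if z: "z \<in> pts F" for z
    proof -
      have zz: "fst z \<in> pts Y" "snd z \<in> pts J" using z by auto
      show "fst z \<in> A \<longleftrightarrow> fst ` orbit G (act F) z = A"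
        unfolding fp_orbit_fst[OF z]
        using gorbit_of[OF objs_gset[OF Y] A] orbit_self[OF objs_gset[OF Y] zz(1)] by blast
      show "snd z \<in> B \<longleftrightarrow> snd ` orbit G (act F) z = B"
        unfolding fp_orbit_snd[OF z]
        using gorbit_of[OF objs_gset[OF J] B] orbit_self[OF objs_gset[OF J] zz(2)] by blast
    qed
    have "gorbits G ?F = orbit G (act F) ` {z \<in> pts F. fst z \<in> A \<and> snd z \<in> B}"
      unfolding gorbits_eq[of G ?F] pF[symmetric] by (rule image_cong[OF refl]) (rule o)
    also have "\<dots> = {z \<in> gorbits G F. fst ` z = A \<and> snd ` z = B}"
      unfolding gorbits_eq[of G F] using iff by blast
    finally show ?thesis .
  qed
  finally show "odd (card {z \<in> gorbits G F. fst ` z = A \<and> snd ` z = B})" .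
qed

text \<open>Ensures that the exponent \<open>card ZZ - card (gorbits G J)\<close> in
  \<open>fiber_sum\<close> is a genuine difference.\<close>

lemma amalg_card: "ZZ \<in> amalgs \<Longrightarrow> card (gorbits G J) \<le> card ZZ"
  using card_image_le[of ZZ "(`) snd"] finite_subset[OF _ fp_finite] unfolding amalgs_def by auto

lemma amalg_eqI:
  assumes ZZ: "ZZ1 \<in> amalgs" "ZZ2 \<in> amalgs" and U: "\<Union>ZZ1 = \<Union>ZZ2"
  shows "ZZ1 = ZZ2"
proof -
  have "ZZ1 \<subseteq> ZZ2" if ZZ: "ZZ1 \<in> amalgs" "ZZ2 \<in> amalgs" and U: "\<Union>ZZ1 = \<Union>ZZ2" for ZZ1 ZZ2
  proof
    fix A assume AZ: "A \<in> ZZ1"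
    then have A: "A \<in> gorbits G F" using ZZ unfolding amalgs_def by auto
    obtain x where x: "x \<in> A" using gorbit_nonempty[OF fp_gset A] by auto
    then have "x \<in> \<Union>ZZ2" using AZ U by blast
    then obtain C where C: "C \<in> ZZ2" "x \<in> C" by blast
    then have CF: "C \<in> gorbits G F" using ZZ unfolding amalgs_def by auto
    show "A \<in> ZZ2" using gorbit_of[OF fp_gset A x] gorbit_of[OF fp_gset CF C(2)] C(1) by simp
  qed
  then show ?thesis using ZZ U by (intro subset_antisym) auto
qed

end

end

section \<open>Maps between the transitive sets of germs\<close>

lemma atoms_gset: "Z \<in> atoms G C \<Longrightarrow> is_gset G Z"
  unfolding atoms_def is_gset_def transitive_action_def by auto

locale universal_homogeneous =
  order_gset G T E + pro_object G E P
  for G :: "('g, 'm) monoid_scheme" and T :: "'g topology"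
    and E :: "('g, nat \<times> 'g set) gset set" and P :: "('i, 'g, nat \<times> 'g set) prosys" +
  assumes universal: "universal_pro G E P" and homogeneous: "homogeneous_pro G E P"
begin

abbreviation "A\<Omega> \<equiv> pro_Aut G P"

abbreviation "B \<equiv> BB G P"

abbreviation "push \<equiv> germ_push G P"

lemma germ_exists:
  assumes "X \<in> nonempty_objs E"
  obtains a where "a \<in> germs G P X"
  using universal assms unfolding universal_pro_def by blast

lemma germs_transitive:
  assumes "X \<in> nonempty_objs E" "a \<in> germs G P X" "b \<in> germs G P X"
  obtains \<sigma> where "\<sigma> \<in> carrier A\<Omega>" "act (B X) \<sigma> a = b"
proof -
  obtain \<sigma> where \<sigma>: "\<sigma> \<in> carrier A\<Omega>" "germ_comp G P X a \<sigma> = b"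
    using homogeneous assms unfolding homogeneous_pro_def by blast
  interpret group A\<Omega> by (rule Aut_group)
  \<comment> \<open>Homogeneity is stated with precomposition, whereas the action precomposes with
    the inverse; hence the inverse as witness.\<close>
  show thesis
    by (rule that[of "inv\<^bsub>A\<Omega>\<^esub> \<sigma>"]) (use \<sigma> assms in \<open>simp_all add: BB_act\<close>)
qed

lemma act_germ: "\<sigma> \<in> carrier A\<Omega> \<Longrightarrow> a \<in> germs G P X \<Longrightarrow> act (B X) \<sigma> a \<in> germs G P X"
  using gset_closed[OF BB_gset[of X], of \<sigma> a] by simp

text \<open>
  If \<open>b\<close> and \<open>\<phi> b\<close> are the images of \<open>c \<in> B W\<close> under \<open>u\<close> and \<open>v\<close>, then the stabilizer of \<open>b\<close> fixes
  \<open>\<phi> b\<close>, and homogeneity applied to \<open>W \<times>\<^sub>Y W\<close> shows that \<open>v\<close> factors through \<open>u\<close>.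
\<close>

lemma map_from_surj:
  assumes X: "X \<in> nonempty_objs E" and Y: "Y \<in> nonempty_objs E" and \<phi>: "\<phi> \<in> gmaps A\<Omega> (B Y) (B X)"
  obtains f where "f \<in> gsurjs G Y X" "\<forall>b\<in>germs G P Y. \<phi> b = push X f b"
proof -
  obtain b where b: "b \<in> germs G P Y" using germ_exists[OF Y] .
  have a: "\<phi> b \<in> germs G P X" using gmaps_closed[OF \<phi>] b by simp
  obtain W c u v where W: "W \<in> nonempty_objs E" and c: "c \<in> germs G P W"
    and u: "u \<in> gsurjs G W Y" and v: "v \<in> gsurjs G W X"
    and bc: "b = push Y u c" and ac: "\<phi> b = push X v c"
    by (rule germ_joint_lift[OF b a])
  note gW = objs_gset[OF W]
  define S where "S = {(w, w') \<in> pts W \<times> pts W. u w = u w'}"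
  have S: "act (prod_gset W W) g z \<in> S" if "g \<in> carrier G" "z \<in> S" for g z
    unfolding S_def
    by (rule fiber_prod_closed[OF gW gW gsurjs_gmaps[OF u] gsurjs_gmaps[OF u] that(1)])
       (use that(2) in \<open>simp add: S_def\<close>)
  have SW: "S \<subseteq> pts W \<times> pts W" by (auto simp: S_def)
  have diag: "(\<lambda>w. (w, w)) ` pts W \<subseteq> S" unfolding S_def by (rule image_subsetI) simp
  have "fst ` S \<subseteq> pts W" "snd ` S \<subseteq> pts W" using SW by auto
  moreover have "pts W \<subseteq> fst ` S" "pts W \<subseteq> snd ` S"
    using image_mono[OF diag, of fst] image_mono[OF diag, of snd] by (simp_all add: image_image)
  ultimately have S2: "fst ` S = pts W" "snd ` S = pts W" by (simp_all only: set_eq_subset)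
  obtain Z p q where Z: "Z \<in> nonempty_objs E" and p: "p \<in> gsurjs G Z W" and q: "q \<in> gsurjs G Z W"
    and bij: "bij_betw (\<lambda>z. (p z, q z)) (pts Z) S"
    by (rule objs_prod_sub[OF W W SW S S2])
  note gZ = objs_gset[OF Z]
  have up: "compose (pts Z) u p = compose (pts Z) u q"
  proof -
    have "u (p z) = u (q z)" if "z \<in> pts Z" for z
      using bij_betw_apply[OF bij that] by (simp add: S_def)
    then show ?thesis by (auto simp: compose_def fun_eq_iff)
  qed
  obtain d0 where d0: "d0 \<in> germs G P Z" using germ_exists[OF Z] .
  \<comment> \<open>An arbitrary germ of \<open>Z\<close> is moved by the group until its first
    projection is the given \<open>c\<close>.\<close>
  obtain \<sigma> where \<sigma>: "\<sigma> \<in> carrier A\<Omega>" "act (B W) \<sigma> (push W p d0) = c"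
    using germs_transitive[OF W germ_push_in[OF p d0] c] .
  define d where "d = act (B Z) \<sigma> d0"
  have d: "d \<in> germs G P Z" unfolding d_def by (rule act_germ[OF \<sigma>(1) d0])
  have pd: "push W p d = c" using \<sigma> act_push[OF p \<sigma>(1) d0] by (simp add: d_def)
  \<comment> \<open>\<open>\<tau>\<close> moves \<open>c\<close>, the first projection of
    \<open>d\<close>, to the second one. The two have the same image under \<open>u\<close>, so
    \<open>\<tau>\<close> fixes \<open>b\<close>.\<close>
  obtain \<tau> where \<tau>: "\<tau> \<in> carrier A\<Omega>" "act (B W) \<tau> c = push W q d"
    using germs_transitive[OF W c germ_push_in[OF q d]] .
  have "act (B Y) \<tau> b = push Y u (push W q d)"
    unfolding bc using act_push[OF u \<tau>(1) c] \<tau>(2) by simp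
  also have "\<dots> = push Y u (push W p d)"
    using germ_push_compose[OF gZ q u d] germ_push_compose[OF gZ p u d] up by simp
  also have "\<dots> = b" using pd bc by simp
  finally have \<tau>b: "act (B Y) \<tau> b = b" .
  \<comment> \<open>As \<open>\<phi>\<close> is equivariant, \<open>\<tau>\<close> also fixes
    \<open>\<phi> b\<close>. Hence \<open>v\<close> takes the same value on both projections of
    \<open>d\<close>, and cancelling the germ \<open>d\<close> gives an equality of
    surjections.\<close>
  have "push X (compose (pts Z) v q) d = push X v (push W q d)"
    by (rule germ_push_compose[OF gZ q v d])
  also have "\<dots> = act (B X) \<tau> (\<phi> b)" using act_push[OF v \<tau>(1) c] \<tau>(2) ac by simp
  also have "\<dots> = \<phi> b" using gmaps_equi[OF \<phi> \<tau>(1), of b] b \<tau>b by simp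
  also have "\<dots> = push X (compose (pts Z) v p) d"
    using germ_push_compose[OF gZ p v d] pd ac by simp
  finally have "push X (compose (pts Z) v q) d = push X (compose (pts Z) v p) d" .
  then have vpq: "compose (pts Z) v q = compose (pts Z) v p"
    by (rule germ_push_inj[OF gsurjs_compose[OF gZ q v] gsurjs_compose[OF gZ p v] d])
  have "v w = v w'" if w: "w \<in> pts W" "w' \<in> pts W" "u w = u w'" for w w'
  proof -
    have "(w, w') \<in> S" using w by (simp add: S_def)
    then obtain z where z: "z \<in> pts Z" "(w, w') = (p z, q z)" using bij unfolding bij_betw_def by blast
    have "compose (pts Z) v q z = compose (pts Z) v p z" by (simp only: vpq)
    then show ?thesis using z by (simp add: compose_eq)
  qed
  then obtain f where f: "f \<in> gsurjs G Y X" and vf: "v = compose (pts W) f u"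
    using gsurjs_factor[OF gW u v] by blast
  have ab: "\<phi> b = push X f b" using ac bc vf germ_push_compose[OF gW u f c] by simp
  \<comment> \<open>Both sides are equivariant and agree at \<open>b\<close>, so transitivity
    extends the agreement to every germ.\<close>
  have "\<phi> b' = push X f b'" if b': "b' \<in> germs G P Y" for b'
  proof -
    obtain \<sigma> where \<sigma>: "\<sigma> \<in> carrier A\<Omega>" "act (B Y) \<sigma> b = b'"
      using germs_transitive[OF Y b b'] .
    then show ?thesis using gmaps_equi[OF \<phi> \<sigma>(1), of b] b ab act_push[OF f \<sigma>(1) b] by simp
  qed
  then show thesis using that[OF f] by blast
qed

text \<open>An atom of the category is only isomorphic to some \<open>B X\<close>, and
  \<open>X\<close> is not part of its data. The choice made here is shown to be harmless in
  \<open>atom_rank_eq\<close>.\<close>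

definition atom_rank :: "('i \<Rightarrow> ('i, nat \<times> 'g set) germ, ('i, nat \<times> 'g set) germ) gset \<Rightarrow> nat" where
  "atom_rank Z = (SOME n. \<exists>X\<in>nonempty_objs E. giso A\<Omega> Z (B X) \<and> n = card (gorbits G X))"

lemma gmap_card_le:
  assumes "X \<in> nonempty_objs E" "Y \<in> nonempty_objs E" "\<phi> \<in> gmaps A\<Omega> (B Y) (B X)"
  shows "card (gorbits G X) \<le> card (gorbits G Y)"
proof -
  obtain f where "f \<in> gsurjs G Y X" using map_from_surj[OF assms] .
  then show ?thesis using gsurjs_card[OF objs_gset[OF assms(2)]] objs_finite[OF assms(2)] by blast
qed

text \<open>Two candidates \<open>X\<close> and \<open>Y\<close> have isomorphic sets of germs. The
  isomorphism and its inverse come from surjections in opposite directions, so each orbit count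
  bounds the other.\<close>

lemma atom_rank_eq:
  assumes Z: "is_gset A\<Omega> Z" and X: "X \<in> nonempty_objs E" and iso: "giso A\<Omega> Z (B X)"
  shows "atom_rank Z = card (gorbits G X)"
proof -
  have "\<exists>n. \<exists>X\<in>nonempty_objs E. giso A\<Omega> Z (B X) \<and> n = card (gorbits G X)" using X iso by blast
  then have "\<exists>X\<in>nonempty_objs E. giso A\<Omega> Z (B X) \<and> atom_rank Z = card (gorbits G X)"
    unfolding atom_rank_def by (rule someI_ex)
  then obtain Y where Y: "Y \<in> nonempty_objs E" "giso A\<Omega> Z (B Y)" "atom_rank Z = card (gorbits G Y)" by blast
  have "giso A\<Omega> (B Y) (B X)" "giso A\<Omega> (B X) (B Y)"
    using giso_trans[OF BB_gset giso_sym[OF Z]] iso Y(2) by blast+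
  then obtain \<phi> \<psi> where "\<phi> \<in> gmaps A\<Omega> (B Y) (B X)" "\<psi> \<in> gmaps A\<Omega> (B X) (B Y)"
    unfolding giso_def gisos_def by blast
  then show ?thesis using gmap_card_le[OF X Y(1)] gmap_card_le[OF Y(1) X] Y(3) by fastforce
qed

lemma atom_rank_B: "X \<in> nonempty_objs E \<Longrightarrow> atom_rank (B X) = card (gorbits G X)"
proof (rule atom_rank_eq[OF BB_gset])
  have "(\<lambda>x\<in>pts (B X). x) \<in> gisos A\<Omega> (B X) (B X)"
    using gsurjs_id[OF BB_gset[of X]] unfolding gsurjs_def gisos_def by (auto simp: bij_betw_def inj_on_def)
  then show "giso A\<Omega> (B X) (B X)" unfolding giso_def by blast
qed

lemma atom_iso:
  assumes Z: "Z \<in> atoms A\<Omega> (CC G E P)"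
  obtains X \<theta> where "X \<in> nonempty_objs E" "\<theta> \<in> gisos A\<Omega> (B X) Z" "atom_rank Z = card (gorbits G X)"
proof -
  note gZ = atoms_gset[OF Z]
  have tr: "transitive_action A\<Omega> (pts Z) (act Z)" and "pts Z \<noteq> {}" and CC: "Z \<in> CC G E P"
    using Z unfolding atoms_def by auto
  then obtain z where z: "z \<in> pts Z" by auto
  have "\<exists>g\<in>carrier A\<Omega>. act Z g z = y" if "y \<in> pts Z" for y
    using transitive_action.unique_orbit[OF tr z that] .
  then have "pts Z \<subseteq> orbit A\<Omega> (act Z) z" unfolding orbit_def by blast
  then have "orbit A\<Omega> (act Z) z = pts Z" using orbit_subset[OF gZ z] by blast
  then have "pts Z \<in> gorbits A\<Omega> Z" using z unfolding gorbits_eq by blast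
  then obtain X where X: "X \<in> nonempty_objs E" and iso: "giso A\<Omega> (sub_gset Z (pts Z)) (B X)"
    using CC unfolding CC_def by blast
  \<comment> \<open>As records the two sets may differ in how elements outside the group act, but
    the isomorphisms out of them are the same.\<close>
  have "gisos A\<Omega> (sub_gset Z (pts Z)) (B X) = gisos A\<Omega> Z (B X)"
    unfolding gisos_def gmaps_def by auto
  then have iso: "giso A\<Omega> Z (B X)" using iso unfolding giso_def by simp
  obtain \<theta> where "\<theta> \<in> gisos A\<Omega> (B X) Z" using giso_sym[OF gZ iso] unfolding giso_def by blast
  then show thesis using that X atom_rank_eq[OF gZ X iso] by blast
qed

lemma atom_map:
  assumes X: "X \<in> nonempty_objs E" and \<theta>X: "\<theta>X \<in> gisos A\<Omega> (B X) X'"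
    and Y: "Y \<in> nonempty_objs E" and \<theta>Y: "\<theta>Y \<in> gisos A\<Omega> (B Y) Y'"
    and f: "f \<in> gmaps A\<Omega> Y' X'"
  obtains f0 where "f0 \<in> gsurjs G Y X" "\<forall>b\<in>germs G P Y. f (\<theta>Y b) = \<theta>X (push X f0 b)"
proof -
  obtain h where h: "h \<in> gisos A\<Omega> X' (B X)" and \<theta>h: "\<And>x. x \<in> pts X' \<Longrightarrow> \<theta>X (h x) = x"
    using gisos_inv[OF BB_gset \<theta>X] by metis
  have f\<theta>: "compose (pts (B Y)) f \<theta>Y \<in> gmaps A\<Omega> (B Y) X'"
    by (rule gmaps_compose[OF BB_gset gisosD(1)[OF \<theta>Y] f])
  obtain f0 where f0: "f0 \<in> gsurjs G Y X"
    and eq: "\<forall>b\<in>germs G P Y. compose (pts (B Y)) h (compose (pts (B Y)) f \<theta>Y) b = push X f0 b"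
    using map_from_surj[OF X Y gmaps_compose[OF BB_gset f\<theta> gisosD(1)[OF h]]] .
  have "f (\<theta>Y b) = \<theta>X (push X f0 b)" if b: "b \<in> germs G P Y" for b
  proof -
    have "f (\<theta>Y b) \<in> pts X'" using gmaps_closed[OF f\<theta>, of b] b by (simp add: compose_eq)
    then show ?thesis using bspec[OF eq b] b \<theta>h[of "f (\<theta>Y b)"] by (simp add: compose_eq)
  qed
  then show thesis using that[OF f0] by blast
qed

lemma atom_rank_mono:
  assumes Y: "Y \<in> atoms A\<Omega> (CC G E P)" and X: "X \<in> atoms A\<Omega> (CC G E P)" and f: "f \<in> gmaps A\<Omega> Y X"
  shows "atom_rank X \<le> atom_rank Y"
proof -
  obtain X0 \<theta>X where X0: "X0 \<in> nonempty_objs E" "\<theta>X \<in> gisos A\<Omega> (B X0) X" "atom_rank X = card (gorbits G X0)"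
    using atom_iso[OF X] .
  obtain Y0 \<theta>Y where Y0: "Y0 \<in> nonempty_objs E" "\<theta>Y \<in> gisos A\<Omega> (B Y0) Y" "atom_rank Y = card (gorbits G Y0)"
    using atom_iso[OF Y] .
  obtain f0 where "f0 \<in> gsurjs G Y0 X0" using atom_map[OF X0(1,2) Y0(1,2) f] .
  then show ?thesis
    using gsurjs_card[OF objs_gset[OF Y0(1)]] objs_finite[OF Y0(1)] X0(3) Y0(3) by simp
qed

lemma atom_rank_iso:
  assumes "Y \<in> atoms A\<Omega> (CC G E P)" "X \<in> atoms A\<Omega> (CC G E P)" "f \<in> gisos A\<Omega> Y X"
  shows "atom_rank X = atom_rank Y"
proof -
  obtain h where "h \<in> gisos A\<Omega> X Y" using gisos_inv[OF atoms_gset[OF assms(1)] assms(3)] by metis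
  then show ?thesis
    using atom_rank_mono[OF assms(1,2) gisosD(1)[OF assms(3)]] atom_rank_mono[OF assms(2,1)] gisosD(1)
    by (metis le_antisym)
qed

text \<open>Two germs to a one-point set come from two surjections of one object onto the point,
  which coincide; so the set of germs is again a point. This accounts for the 1 subtracted in the
  final exponent.\<close>

lemma atom_rank_point: "atom_rank (point_gset p) = 1"
proof -
  fix q0 :: "nat \<times> 'g set"
  let ?q = "point_gset q0 :: ('g, nat \<times> 'g set) gset"
  have Q: "?q \<in> nonempty_objs E"
    using is_orderD(2)[OF order] unfolding nonempty_objs_def by (simp add: point_gset_def)
  have pt: "is_gset A\<Omega> (point_gset p)"
    by (rule is_gsetI[OF Aut_group]) (auto simp: point_gset_def)
  obtain a where a: "a \<in> germs G P ?q" using germ_exists[OF Q] .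
  have single: "b = a" if b: "b \<in> germs G P ?q" for b
  proof -
    obtain W c u v where "u \<in> gsurjs G W ?q" "v \<in> gsurjs G W ?q" "a = push ?q u c" "b = push ?q v c"
      using germ_joint_lift[OF a b] .
    moreover from this have "u = v"
      using gmaps_closed[OF gsurjs_gmaps, of u G W ?q] gmaps_closed[OF gsurjs_gmaps, of v G W ?q]
      by (intro gmaps_eqI[OF gsurjs_gmaps gsurjs_gmaps]) (auto simp: point_gset_def)
    ultimately show ?thesis by simp
  qed
  have "(\<lambda>x\<in>{p}. a) \<in> gisos A\<Omega> (point_gset p) (B ?q)"
  proof (rule gisosI)
    show "(\<lambda>x\<in>{p}. a) \<in> gmaps A\<Omega> (point_gset p) (B ?q)"
      unfolding gmaps_def using a single[OF act_germ[OF _ a]] by (auto simp: point_gset_def)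
  qed (use single in \<open>auto simp: point_gset_def\<close>)
  then have "atom_rank (point_gset p) = card (gorbits G ?q)"
    by (intro atom_rank_eq[OF pt Q]) (auto simp: giso_def)
  also have "gorbits G ?q = {{q0}}"
    unfolding gorbits_eq orbit_def using group.is_monoid[OF gset_group[OF objs_gset[OF Q]]]
    by (auto simp: point_gset_def intro: monoid.one_closed)
  finally show ?thesis by simp
qed

end

section \<open>The measure\<close>

context universal_homogeneous
begin

text \<open>The orbits of the fiber product correspond to the amalgams of \<open>Y0\<close> and
  \<open>J0\<close> over \<open>X0\<close>: the germs of an amalgam, projected to both factors, form
  exactly one orbit. The ranks on the right are thus sizes of amalgams, and
  \<open>amalgs_sum\<close> evaluates the sum.\<close>

lemma fiber_sum:
  assumes odd: "odd_order G E"
    and Y: "Y \<in> atoms A\<Omega> (CC G E P)" and X: "X \<in> atoms A\<Omega> (CC G E P)" and J: "J \<in> atoms A\<Omega> (CC G E P)"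
    and f: "f \<in> gmaps A\<Omega> Y X" and h: "h \<in> gmaps A\<Omega> J X"
    and W: "\<And>A. A \<in> gorbits A\<Omega> (fiber_prod Y f J h) \<Longrightarrow> W A \<in> atoms A\<Omega> (CC G E P)"
    and e: "\<And>A. A \<in> gorbits A\<Omega> (fiber_prod Y f J h) \<Longrightarrow>
              e A \<in> gisos A\<Omega> (W A) (sub_gset (fiber_prod Y f J h) A)"
  shows "(- 2 :: int) ^ (atom_rank Y - atom_rank X) =
    (\<Sum>A\<in>gorbits A\<Omega> (fiber_prod Y f J h). (- 2) ^ (atom_rank (W A) - atom_rank J))"
proof -
  obtain X0 \<theta>X where X0: "X0 \<in> nonempty_objs E" and \<theta>X: "\<theta>X \<in> gisos A\<Omega> (B X0) X"
    and rX: "atom_rank X = card (gorbits G X0)" using atom_iso[OF X] .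
  obtain Y0 \<theta>Y where Y0: "Y0 \<in> nonempty_objs E" and \<theta>Y: "\<theta>Y \<in> gisos A\<Omega> (B Y0) Y"
    and rY: "atom_rank Y = card (gorbits G Y0)" using atom_iso[OF Y] .
  obtain J0 \<theta>J where J0: "J0 \<in> nonempty_objs E" and \<theta>J: "\<theta>J \<in> gisos A\<Omega> (B J0) J"
    and rJ: "atom_rank J = card (gorbits G J0)" using atom_iso[OF J] .
  obtain f0 where f0: "f0 \<in> gsurjs G Y0 X0"
    and ff0: "\<forall>b\<in>germs G P Y0. f (\<theta>Y b) = \<theta>X (push X0 f0 b)"
    using atom_map[OF X0 \<theta>X Y0 \<theta>Y f] .
  obtain h0 where h0: "h0 \<in> gsurjs G J0 X0"
    and hh0: "\<forall>b\<in>germs G P J0. h (\<theta>J b) = \<theta>X (push X0 h0 b)"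
    using atom_map[OF X0 \<theta>X J0 \<theta>J h] .
  let ?F = "fiber_prod Y f J h"
  let ?am = "amalgs Y0 J0 f0 h0"
  note gY = atoms_gset[OF Y] and gJ = atoms_gset[OF J]
  have gF: "is_gset A\<Omega> ?F" by (rule fiber_prod_gset[OF gY gJ f h])
  \<comment> \<open>The object, its two projections and a base germ are chosen together, as one
    tuple for each amalgam.\<close>
  let ?R = "\<lambda>ZZ Z p q d. Z \<in> nonempty_objs E \<and> p \<in> gsurjs G Z Y0 \<and> q \<in> gsurjs G Z J0 \<and>
      bij_betw (\<lambda>z. (p z, q z)) (pts Z) (\<Union>ZZ) \<and> card (gorbits G Z) = card ZZ \<and> d \<in> germs G P Z"
  have "\<exists>t. ?R ZZ (fst t) (fst (snd t)) (fst (snd (snd t))) (snd (snd (snd t)))"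
    if ZZ: "ZZ \<in> ?am" for ZZ
  proof -
    obtain Z p q where Z: "Z \<in> nonempty_objs E" "p \<in> gsurjs G Z Y0" "q \<in> gsurjs G Z J0"
      "bij_betw (\<lambda>z. (p z, q z)) (pts Z) (\<Union>ZZ)" "card (gorbits G Z) = card ZZ"
      by (rule amalg_object[OF X0 Y0 J0 f0 h0 ZZ])
    obtain d where "d \<in> germs G P Z" using germ_exists[OF Z(1)] .
    then show ?thesis using Z by (intro exI[of _ "(Z, p, q, d)"]) simp
  qed
  then obtain t where
    t: "\<And>ZZ. ZZ \<in> ?am \<Longrightarrow> ?R ZZ (fst (t ZZ)) (fst (snd (t ZZ))) (fst (snd (snd (t ZZ)))) (snd (snd (snd (t ZZ))))"
    using bchoice[of ?am "\<lambda>ZZ t. ?R ZZ (fst t) (fst (snd t)) (fst (snd (snd t))) (snd (snd (snd t)))"] by auto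
  define Z where "Z ZZ = fst (t ZZ)" for ZZ
  define p where "p ZZ = fst (snd (t ZZ))" for ZZ
  define q where "q ZZ = fst (snd (snd (t ZZ)))" for ZZ
  define d where "d ZZ = snd (snd (snd (t ZZ)))" for ZZ
  have tR: "?R ZZ (Z ZZ) (p ZZ) (q ZZ) (d ZZ)" if "ZZ \<in> ?am" for ZZ
    using t[OF that] unfolding Z_def p_def q_def d_def .
  have Z: "Z ZZ \<in> nonempty_objs E" and p: "p ZZ \<in> gsurjs G (Z ZZ) Y0" and q: "q ZZ \<in> gsurjs G (Z ZZ) J0"
    and bij: "bij_betw (\<lambda>z. (p ZZ z, q ZZ z)) (pts (Z ZZ)) (\<Union>ZZ)"
    and cZ: "card (gorbits G (Z ZZ)) = card ZZ" and d: "d ZZ \<in> germs G P (Z ZZ)"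
    if "ZZ \<in> ?am" for ZZ
    using tR[OF that] by simp_all
  \<comment> \<open>The point of the fiber product given by a germ of the amalgam: its two
    projections, carried to \<open>Y\<close> and \<open>J\<close> by the fixed isomorphisms.\<close>
  define pt where "pt ZZ b = (\<theta>Y (push Y0 (p ZZ) b), \<theta>J (push J0 (q ZZ) b))" for ZZ b
  have base: "f0 (p ZZ z) = h0 (q ZZ z)" if ZZ: "ZZ \<in> ?am" and z: "z \<in> pts (Z ZZ)" for ZZ z
  proof -
    have "(p ZZ z, q ZZ z) \<in> \<Union>ZZ" by (rule bij_betw_apply[OF bij[OF ZZ] z])
    moreover have "\<Union>ZZ \<subseteq> pts (fiber_prod Y0 f0 J0 h0)"
      using ZZ Union_gorbits[OF fp_gset[OF X0 Y0 J0 f0 h0]] unfolding amalgs_def[OF X0 Y0 J0 f0 h0] by auto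
    ultimately have "(p ZZ z, q ZZ z) \<in> pts (fiber_prod Y0 f0 J0 h0)" by (rule rev_subsetD)
    then show ?thesis by simp
  qed
  have ptF: "pt ZZ b \<in> pts ?F" if ZZ: "ZZ \<in> ?am" and b: "b \<in> germs G P (Z ZZ)" for ZZ b
  proof -
    note gZ = objs_gset[OF Z[OF ZZ]]
    have pb: "push Y0 (p ZZ) b \<in> germs G P Y0" and qb: "push J0 (q ZZ) b \<in> germs G P J0"
      using germ_push_in p[OF ZZ] q[OF ZZ] b by blast+
    have "compose (pts (Z ZZ)) f0 (p ZZ) = compose (pts (Z ZZ)) h0 (q ZZ)"
      using base[OF ZZ] by (auto simp: compose_def fun_eq_iff)
    then have "push X0 f0 (push Y0 (p ZZ) b) = push X0 h0 (push J0 (q ZZ) b)"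
      using germ_push_compose[OF gZ p[OF ZZ] f0 b] germ_push_compose[OF gZ q[OF ZZ] h0 b] by simp
    then have "f (\<theta>Y (push Y0 (p ZZ) b)) = h (\<theta>J (push J0 (q ZZ) b))"
      using bspec[OF ff0 pb] bspec[OF hh0 qb] by simp
    then show ?thesis
      unfolding pt_def using gmaps_closed[OF gisosD(1)[OF \<theta>Y], of "push Y0 (p ZZ) b"] pb
        gmaps_closed[OF gisosD(1)[OF \<theta>J], of "push J0 (q ZZ) b"] qb by simp
  qed
  have ptact: "pt ZZ (act (B (Z ZZ)) \<sigma> b) = act ?F \<sigma> (pt ZZ b)"
    if ZZ: "ZZ \<in> ?am" and b: "b \<in> germs G P (Z ZZ)" and \<sigma>: "\<sigma> \<in> carrier A\<Omega>" for ZZ b \<sigma>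
  proof -
    have pb: "push Y0 (p ZZ) b \<in> germs G P Y0" and qb: "push J0 (q ZZ) b \<in> germs G P J0"
      using germ_push_in p[OF ZZ] q[OF ZZ] b by blast+
    have "pt ZZ (act (B (Z ZZ)) \<sigma> b) = (act Y \<sigma> (\<theta>Y (push Y0 (p ZZ) b)), act J \<sigma> (\<theta>J (push J0 (q ZZ) b)))"
      unfolding pt_def act_push[OF p[OF ZZ] \<sigma> b, symmetric] act_push[OF q[OF ZZ] \<sigma> b, symmetric]
      using gmaps_equi[OF gisosD(1)[OF \<theta>Y] \<sigma>, of "push Y0 (p ZZ) b"] pb
        gmaps_equi[OF gisosD(1)[OF \<theta>J] \<sigma>, of "push J0 (q ZZ) b"] qb by simp
    also have "\<dots> = act ?F \<sigma> (pt ZZ b)"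
      using ptF[OF ZZ b] unfolding pt_def by simp
    finally show ?thesis .
  qed
  have pt_eq: "push Y0 (p ZZ) b = push Y0 (p ZZ') b' \<and> push J0 (q ZZ) b = push J0 (q ZZ') b'"
    if ZZ: "ZZ \<in> ?am" "ZZ' \<in> ?am" and b: "b \<in> germs G P (Z ZZ)" "b' \<in> germs G P (Z ZZ')"
      and eq: "pt ZZ b = pt ZZ' b'" for ZZ ZZ' b b'
  proof
    have eq1: "\<theta>Y (push Y0 (p ZZ) b) = \<theta>Y (push Y0 (p ZZ') b')"
      and eq2: "\<theta>J (push J0 (q ZZ) b) = \<theta>J (push J0 (q ZZ') b')"
      using eq unfolding pt_def by simp_all
    show "push Y0 (p ZZ) b = push Y0 (p ZZ') b'"
      by (rule inj_onD[OF gisosD(2)[OF \<theta>Y] eq1])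
         (simp_all only: BB_pts germ_push_in[OF p[OF ZZ(1)] b(1)] germ_push_in[OF p[OF ZZ(2)] b(2)])
    show "push J0 (q ZZ) b = push J0 (q ZZ') b'"
      by (rule inj_onD[OF gisosD(2)[OF \<theta>J] eq2])
         (simp_all only: BB_pts germ_push_in[OF q[OF ZZ(1)] b(1)] germ_push_in[OF q[OF ZZ(2)] b(2)])
  qed
  \<comment> \<open>Lift both germs to one germ of some \<open>V\<close>. Cancelling that germ shows
    that \<open>u\<close> and \<open>v\<close> agree after both projections, and these are jointly
    injective.\<close>
  have pt_inj: "b = b'"
    if ZZ: "ZZ \<in> ?am" and b: "b \<in> germs G P (Z ZZ)" "b' \<in> germs G P (Z ZZ)"
      and eq: "pt ZZ b = pt ZZ b'" for ZZ b b'
  proof -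
    obtain V c u v where V: "V \<in> nonempty_objs E" and c: "c \<in> germs G P V" and u: "u \<in> gsurjs G V (Z ZZ)"
      and v: "v \<in> gsurjs G V (Z ZZ)" and bu: "b = push (Z ZZ) u c" and bv: "b' = push (Z ZZ) v c"
      by (rule germ_joint_lift[OF b])
    note gV = objs_gset[OF V]
    have "push Y0 (compose (pts V) (p ZZ) u) c = push Y0 (compose (pts V) (p ZZ) v) c"
      using pt_eq[OF ZZ ZZ b eq] bu bv germ_push_compose[OF gV u p[OF ZZ] c] germ_push_compose[OF gV v p[OF ZZ] c] by simp
    then have pu: "compose (pts V) (p ZZ) u = compose (pts V) (p ZZ) v"
      by (rule germ_push_inj[OF gsurjs_compose[OF gV u p[OF ZZ]] gsurjs_compose[OF gV v p[OF ZZ]] c])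
    have "push J0 (compose (pts V) (q ZZ) u) c = push J0 (compose (pts V) (q ZZ) v) c"
      using pt_eq[OF ZZ ZZ b eq] bu bv germ_push_compose[OF gV u q[OF ZZ] c] germ_push_compose[OF gV v q[OF ZZ] c] by simp
    then have qu: "compose (pts V) (q ZZ) u = compose (pts V) (q ZZ) v"
      by (rule germ_push_inj[OF gsurjs_compose[OF gV u q[OF ZZ]] gsurjs_compose[OF gV v q[OF ZZ]] c])
    have "u = v"
    proof (rule gmaps_eqI[OF gsurjs_gmaps[OF u] gsurjs_gmaps[OF v]])
      fix x assume x: "x \<in> pts V"
      have "p ZZ (u x) = p ZZ (v x)" "q ZZ (u x) = q ZZ (v x)"
        using fun_cong[OF pu, of x] fun_cong[OF qu, of x] x by (simp_all add: compose_eq)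
      then show "u x = v x"
        using bij_betw_imp_inj_on[OF bij[OF ZZ]] gmaps_closed[OF gsurjs_gmaps[OF u] x]
          gmaps_closed[OF gsurjs_gmaps[OF v] x] unfolding inj_on_def by simp
    qed
    then show ?thesis using bu bv by simp
  qed
  \<comment> \<open>After a joint lift to \<open>V\<close>, both amalgams have as union the image of
    \<open>V\<close> in the product of \<open>Y0\<close> and \<open>J0\<close>. The union determines
    the amalgam.\<close>
  have pt_unique: "ZZ = ZZ'"
    if ZZ: "ZZ \<in> ?am" "ZZ' \<in> ?am" and b: "b \<in> germs G P (Z ZZ)" "b' \<in> germs G P (Z ZZ')"
      and eq: "pt ZZ b = pt ZZ' b'" for ZZ ZZ' b b'
  proof -
    obtain V c u v where V: "V \<in> nonempty_objs E" and c: "c \<in> germs G P V" and u: "u \<in> gsurjs G V (Z ZZ)"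
      and v: "v \<in> gsurjs G V (Z ZZ')" and bu: "b = push (Z ZZ) u c" and bv: "b' = push (Z ZZ') v c"
      by (rule germ_joint_lift[OF b])
    note gV = objs_gset[OF V]
    have "push Y0 (compose (pts V) (p ZZ) u) c = push Y0 (compose (pts V) (p ZZ') v) c"
      using pt_eq[OF ZZ b eq] bu bv germ_push_compose[OF gV u p[OF ZZ(1)] c] germ_push_compose[OF gV v p[OF ZZ(2)] c] by simp
    then have pu: "compose (pts V) (p ZZ) u = compose (pts V) (p ZZ') v"
      by (rule germ_push_inj[OF gsurjs_compose[OF gV u p[OF ZZ(1)]] gsurjs_compose[OF gV v p[OF ZZ(2)]] c])
    have "push J0 (compose (pts V) (q ZZ) u) c = push J0 (compose (pts V) (q ZZ') v) c"
      using pt_eq[OF ZZ b eq] bu bv germ_push_compose[OF gV u q[OF ZZ(1)] c] germ_push_compose[OF gV v q[OF ZZ(2)] c] by simp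
    then have qu: "compose (pts V) (q ZZ) u = compose (pts V) (q ZZ') v"
      by (rule germ_push_inj[OF gsurjs_compose[OF gV u q[OF ZZ(1)]] gsurjs_compose[OF gV v q[OF ZZ(2)]] c])
    have im: "\<Union>ZZ = (\<lambda>x. (compose (pts V) (p ZZ) u x, compose (pts V) (q ZZ) u x)) ` pts V"
      if "ZZ \<in> ?am" "u \<in> gsurjs G V (Z ZZ)" for ZZ u
    proof -
      have "\<Union>ZZ = (\<lambda>z. (p ZZ z, q ZZ z)) ` u ` pts V"
        using bij[OF that(1)] gsurjs_image[OF that(2)] unfolding bij_betw_def by simp
      then show ?thesis by (simp add: image_image compose_eq cong: image_cong)
    qed
    have "\<Union>ZZ = \<Union>ZZ'" unfolding im[OF ZZ(1) u] im[OF ZZ(2) v] pu qu ..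
    then show ?thesis by (rule amalg_eqI[OF X0 Y0 J0 f0 h0 ZZ])
  qed
  \<comment> \<open>The two coordinates of a point lift to one germ of some \<open>V\<close>. The
    resulting maps to \<open>Y0\<close> and \<open>J0\<close> agree over \<open>X0\<close>, and the
    image of \<open>V\<close> is the amalgam sought.\<close>
  have pt_cover: "\<exists>ZZ\<in>?am. \<exists>b\<in>germs G P (Z ZZ). z = pt ZZ b" if z: "z \<in> pts ?F" for z
  proof -
    obtain y j where zyj: "z = (y, j)" by (cases z)
    have y: "y \<in> pts Y" and j: "j \<in> pts J" and fh: "f y = h j" using z unfolding zyj by auto
    obtain b where b: "b \<in> germs G P Y0" "y = \<theta>Y b" using y gisosD(3)[OF \<theta>Y] by auto
    obtain b' where b': "b' \<in> germs G P J0" "j = \<theta>J b'" using j gisosD(3)[OF \<theta>J] by auto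
    obtain V c u v where V: "V \<in> nonempty_objs E" and c: "c \<in> germs G P V" and u: "u \<in> gsurjs G V Y0"
      and v: "v \<in> gsurjs G V J0" and bu: "b = push Y0 u c" and bv: "b' = push J0 v c"
      by (rule germ_joint_lift[OF b(1) b'(1)])
    note gV = objs_gset[OF V]
    have "\<theta>X (push X0 f0 b) = \<theta>X (push X0 h0 b')"
      using fh bspec[OF ff0 b(1)] bspec[OF hh0 b'(1)] b b' by simp
    then have "push X0 f0 b = push X0 h0 b'"
      by (rule inj_onD[OF gisosD(2)[OF \<theta>X]])
         (simp_all only: BB_pts germ_push_in[OF f0 b(1)] germ_push_in[OF h0 b'(1)])
    then have "push X0 (compose (pts V) f0 u) c = push X0 (compose (pts V) h0 v) c"
      using germ_push_compose[OF gV u f0 c] germ_push_compose[OF gV v h0 c] bu bv by simp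
    then have fuhv: "compose (pts V) f0 u = compose (pts V) h0 v"
      by (rule germ_push_inj[OF gsurjs_compose[OF gV u f0] gsurjs_compose[OF gV v h0] c])
    have "f0 (u w) = h0 (v w)" if "w \<in> pts V" for w
      using fun_cong[OF fuhv, of w] that by (simp add: compose_eq)
    then obtain ZZ where ZZ: "ZZ \<in> ?am" and im: "(\<lambda>w. (u w, v w)) ` pts V = \<Union>ZZ"
      using amalg_of_maps[OF X0 Y0 J0 f0 h0 gV u v] by blast
    \<comment> \<open>The pair of maps factors through the object that represents its image. Joint
      injectivity of the projections makes the factorization equivariant.\<close>
    obtain \<phi> where \<phi>: "\<phi> \<in> gsurjs G V (Z ZZ)" "\<And>w. w \<in> pts V \<Longrightarrow> p ZZ (\<phi> w) = u w \<and> q ZZ (\<phi> w) = v w"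
    proof -
      let ?pq = "\<lambda>z. (p ZZ z, q ZZ z)"
      define \<phi> where "\<phi> = (\<lambda>w\<in>pts V. inv_into (pts (Z ZZ)) ?pq (u w, v w))"
      have inj: "inj_on ?pq (pts (Z ZZ))" and pqim: "?pq ` pts (Z ZZ) = \<Union>ZZ"
        using bij[OF ZZ] unfolding bij_betw_def by auto
      have mem: "\<phi> w \<in> pts (Z ZZ)" and val: "?pq (\<phi> w) = (u w, v w)" if w: "w \<in> pts V" for w
      proof -
        have uv: "(u w, v w) \<in> ?pq ` pts (Z ZZ)" unfolding pqim im[symmetric] using w by (rule imageI)
        show "\<phi> w \<in> pts (Z ZZ)" using inv_into_into[OF uv] w by (simp add: \<phi>_def)
        show "?pq (\<phi> w) = (u w, v w)" using f_inv_into_f[OF uv] w by (simp add: \<phi>_def)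
      qed
      have "\<phi> (act V g w) = act (Z ZZ) g (\<phi> w)" if g: "g \<in> carrier G" and w: "w \<in> pts V" for g w
      proof (rule inj_onD[OF inj])
        note gw = gset_closed[OF gV g w]
        have "?pq (\<phi> (act V g w)) = (act Y0 g (u w), act J0 g (v w))"
          using val[OF gw] gmaps_equi[OF gsurjs_gmaps[OF u] g w] gmaps_equi[OF gsurjs_gmaps[OF v] g w] by simp
        also have "\<dots> = ?pq (act (Z ZZ) g (\<phi> w))"
          using val[OF w] gmaps_equi[OF gsurjs_gmaps[OF p[OF ZZ]] g mem[OF w]]
            gmaps_equi[OF gsurjs_gmaps[OF q[OF ZZ]] g mem[OF w]] by simp
        finally show "?pq (\<phi> (act V g w)) = ?pq (act (Z ZZ) g (\<phi> w))" .
        show "\<phi> (act V g w) \<in> pts (Z ZZ)" by (rule mem[OF gw])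
        show "act (Z ZZ) g (\<phi> w) \<in> pts (Z ZZ)" by (rule gset_closed[OF objs_gset[OF Z[OF ZZ]] g mem[OF w]])
      qed
      then have gm: "\<phi> \<in> gmaps G V (Z ZZ)"
        using mem unfolding gmaps_def by (simp add: PiE_iff) (simp add: \<phi>_def)
      \<comment> \<open>Surjectivity holds because the amalgam is the exact image of
        \<open>V\<close>; it is what allows a germ of \<open>V\<close> to be pushed to the
        amalgam.\<close>
      have "pts (Z ZZ) \<subseteq> \<phi> ` pts V"
      proof
        fix z assume z: "z \<in> pts (Z ZZ)"
        then have "?pq z \<in> (\<lambda>w. (u w, v w)) ` pts V" unfolding im pqim[symmetric] by (rule imageI)
        then obtain w where w: "w \<in> pts V" "?pq z = (u w, v w)" by blast
        then have "?pq z = ?pq (\<phi> w)" using val[OF w(1)] by simp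
        then have "z = \<phi> w" by (rule inj_onD[OF inj _ z mem[OF w(1)]])
        then show "z \<in> \<phi> ` pts V" using w(1) by blast
      qed
      then have "\<phi> \<in> gsurjs G V (Z ZZ)" using gm mem unfolding gsurjs_def by blast
      then show thesis using that val by blast
    qed
    have "compose (pts V) (p ZZ) \<phi> = u" "compose (pts V) (q ZZ) \<phi> = v"
      using \<phi>(2) gmaps_ext[OF gsurjs_gmaps[OF u]] gmaps_ext[OF gsurjs_gmaps[OF v]]
      by (auto simp: compose_def fun_eq_iff restrict_def extensional_def)
    then have "pt ZZ (push (Z ZZ) \<phi> c) = z"
      unfolding pt_def zyj using germ_push_compose[OF gV \<phi>(1) p[OF ZZ] c] germ_push_compose[OF gV \<phi>(1) q[OF ZZ] c]
        b b' bu bv by simp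
    then show ?thesis using ZZ germ_push_in[OF \<phi>(1) c] by blast
  qed
  \<comment> \<open>Defined through the base germ so as to be visibly an orbit. Transitivity on
    germs shows next that it is the whole image of \<open>pt ZZ\<close>.\<close>
  define \<Phi> where "\<Phi> ZZ = orbit A\<Omega> (act ?F) (pt ZZ (d ZZ))" for ZZ
  have \<Phi>: "\<Phi> ZZ = pt ZZ ` germs G P (Z ZZ)" if ZZ: "ZZ \<in> ?am" for ZZ
  proof (intro equalityI subsetI)
    fix z assume "z \<in> \<Phi> ZZ"
    then obtain \<sigma> where "\<sigma> \<in> carrier A\<Omega>" "z = act ?F \<sigma> (pt ZZ (d ZZ))" unfolding \<Phi>_def by (rule orbitE)
    then show "z \<in> pt ZZ ` germs G P (Z ZZ)"
      using ptact[OF ZZ d[OF ZZ]] act_germ[OF _ d[OF ZZ]] by (metis imageI)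
  next
    fix z assume "z \<in> pt ZZ ` germs G P (Z ZZ)"
    then obtain b where b: "b \<in> germs G P (Z ZZ)" "z = pt ZZ b" by blast
    obtain \<sigma> where \<sigma>: "\<sigma> \<in> carrier A\<Omega>" "act (B (Z ZZ)) \<sigma> (d ZZ) = b"
      using germs_transitive[OF Z[OF ZZ] d[OF ZZ] b(1)] .
    then have "z = act ?F \<sigma> (pt ZZ (d ZZ))" using ptact[OF ZZ d[OF ZZ] \<sigma>(1)] b(2) by simp
    then show "z \<in> \<Phi> ZZ" unfolding \<Phi>_def using orbit_actI[OF \<sigma>(1), of ?F] by blast
  qed
  have bij\<Phi>: "bij_betw \<Phi> ?am (gorbits A\<Omega> ?F)"
    unfolding bij_betw_def
  proof
    show "inj_on \<Phi> ?am"
    proof (rule inj_onI)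
      fix ZZ ZZ' assume ZZ: "ZZ \<in> ?am" "ZZ' \<in> ?am" and eq: "\<Phi> ZZ = \<Phi> ZZ'"
      have "pt ZZ (d ZZ) \<in> pt ZZ' ` germs G P (Z ZZ')"
        using eq d[OF ZZ(1)] unfolding \<Phi>[OF ZZ(1)] \<Phi>[OF ZZ(2)] by blast
      then show "ZZ = ZZ'" using pt_unique[OF ZZ d[OF ZZ(1)]] by blast
    qed
    show "\<Phi> ` ?am = gorbits A\<Omega> ?F"
    proof (intro equalityI subsetI)
      fix A assume "A \<in> \<Phi> ` ?am"
      then obtain ZZ where ZZ: "ZZ \<in> ?am" "A = \<Phi> ZZ" by blast
      show "A \<in> gorbits A\<Omega> ?F"
        unfolding gorbits_eq ZZ(2) \<Phi>_def by (rule imageI[OF ptF[OF ZZ(1) d[OF ZZ(1)]]])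
    next
      fix A assume A: "A \<in> gorbits A\<Omega> ?F"
      obtain z where z: "z \<in> A" using gorbit_nonempty[OF gF A] by blast
      have zF: "z \<in> pts ?F" and Az: "A = orbit A\<Omega> (act ?F) z" using gorbit_of[OF gF A z] by blast+
      obtain ZZ b where ZZ: "ZZ \<in> ?am" "b \<in> germs G P (Z ZZ)" "z = pt ZZ b" using pt_cover[OF zF] by blast
      then have "z \<in> \<Phi> ZZ" unfolding \<Phi>[OF ZZ(1)] by blast
      then have "A = \<Phi> ZZ" unfolding Az \<Phi>_def by (rule orbit_eqI[OF gF ptF[OF ZZ(1) d[OF ZZ(1)]]])
      then show "A \<in> \<Phi> ` ?am" using ZZ(1) by blast
    qed
  qed
  \<comment> \<open>\<open>pt\<close> identifies the germs of the amalgam with the orbit, and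
    \<open>e\<close> identifies the orbit with its representative \<open>W\<close>. Only the
    isomorphism class of \<open>W\<close> enters the rank, so an arbitrary choice of
    \<open>W\<close> and \<open>e\<close> is covered.\<close>
  have rk: "atom_rank (W (\<Phi> ZZ)) = card ZZ" if ZZ: "ZZ \<in> ?am" for ZZ
  proof -
    have A: "\<Phi> ZZ \<in> gorbits A\<Omega> ?F" using bij_betw_apply[OF bij\<Phi> ZZ] .
    let ?pt = "\<lambda>b\<in>germs G P (Z ZZ). pt ZZ b"
    have mem: "pt ZZ b \<in> \<Phi> ZZ" if "b \<in> germs G P (Z ZZ)" for b using that unfolding \<Phi>[OF ZZ] by blast
    have iso: "?pt \<in> gisos A\<Omega> (B (Z ZZ)) (sub_gset ?F (\<Phi> ZZ))"
    proof (rule gisosI)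
      show "?pt \<in> gmaps A\<Omega> (B (Z ZZ)) (sub_gset ?F (\<Phi> ZZ))"
        unfolding gmaps_def by (simp add: PiE_iff mem act_germ ptact[OF ZZ])
      show "inj_on ?pt (pts (B (Z ZZ)))"
        by (rule inj_onI) (use pt_inj[OF ZZ] in simp)
      show "pts (sub_gset ?F (\<Phi> ZZ)) \<subseteq> ?pt ` pts (B (Z ZZ))" by (simp add: \<Phi>[OF ZZ])
    qed
    have gW: "is_gset A\<Omega> (W (\<Phi> ZZ))" by (rule atoms_gset[OF W[OF A]])
    have "giso A\<Omega> (W (\<Phi> ZZ)) (sub_gset ?F (\<Phi> ZZ))" using e[OF A] unfolding giso_def by blast
    moreover have "giso A\<Omega> (sub_gset ?F (\<Phi> ZZ)) (B (Z ZZ))"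
      by (rule giso_sym[OF BB_gset]) (use iso in \<open>auto simp only: giso_def\<close>)
    ultimately have "giso A\<Omega> (W (\<Phi> ZZ)) (B (Z ZZ))" by (rule giso_trans[OF gW])
    then show ?thesis using atom_rank_eq[OF gW Z[OF ZZ]] cZ[OF ZZ] by simp
  qed
  have "(\<Sum>A\<in>gorbits A\<Omega> ?F. (- 2 :: int) ^ (atom_rank (W A) - atom_rank J)) =
      (\<Sum>ZZ\<in>?am. (- 2) ^ (atom_rank (W (\<Phi> ZZ)) - atom_rank J))"
    by (rule sum.reindex_bij_betw[OF bij\<Phi>, symmetric])
  also have "\<dots> = (\<Sum>ZZ\<in>?am. (- 2) ^ (card ZZ - card (gorbits G J0)))"
    by (rule sum.cong[OF refl]) (simp add: rk rJ)
  \<comment> \<open>Both sides are multiplied by the power belonging to \<open>J0\<close>, which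
    undoes the subtraction in the exponents. This nonzero factor is cancelled at the end.\<close>
  finally have "(- 2) ^ card (gorbits G J0) * (\<Sum>A\<in>gorbits A\<Omega> ?F. (- 2 :: int) ^ (atom_rank (W A) - atom_rank J)) =
      (\<Sum>ZZ\<in>?am. (- 2) ^ card (gorbits G J0) * (- 2) ^ (card ZZ - card (gorbits G J0)))"
    by (simp only: sum_distrib_left)
  also have "\<dots> = (\<Sum>ZZ\<in>?am. (- 2) ^ card ZZ)"
    by (rule sum.cong[OF refl]) (use amalg_card[OF X0 Y0 J0 f0 h0] in \<open>simp flip: power_add\<close>)
  also have "\<dots> = (- 2) ^ (atom_rank Y - atom_rank X) * (- 2) ^ card (gorbits G J0)"
    unfolding rY rX by (rule amalgs_sum[OF X0 Y0 J0 f0 h0 odd])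
  finally show ?thesis by simp
qed

text \<open>The value depends only on source and target. Multiplicativity is the addition of rank
  differences, which \<open>atom_rank_mono\<close> keeps from being truncated; base change is
  \<open>fiber_sum\<close>.\<close>

lemma order_measure_rank:
  assumes odd: "odd_order G E"
  shows "order_measure A\<Omega> (CC G E P) (\<lambda>Y X f. (- 2 :: int) ^ (atom_rank Y - atom_rank X))"
  unfolding order_measure_def
proof (intro conjI ballI allI impI)
  fix Y X f assume "Y \<in> atoms A\<Omega> (CC G E P)" "X \<in> atoms A\<Omega> (CC G E P)" "f \<in> gisos A\<Omega> Y X"
  then show "(- 2 :: int) ^ (atom_rank Y - atom_rank X) = 1" using atom_rank_iso by simp
next
  fix Y X Z f h
  assume "Y \<in> atoms A\<Omega> (CC G E P)" "X \<in> atoms A\<Omega> (CC G E P)" "Z \<in> atoms A\<Omega> (CC G E P)"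
    "f \<in> gmaps A\<Omega> Y X" "h \<in> gmaps A\<Omega> X Z"
  then have "atom_rank X \<le> atom_rank Y" "atom_rank Z \<le> atom_rank X" by (auto intro: atom_rank_mono)
  then show "(- 2 :: int) ^ (atom_rank Y - atom_rank Z) =
      (- 2) ^ (atom_rank X - atom_rank Z) * (- 2) ^ (atom_rank Y - atom_rank X)"
    by (simp flip: power_add)
next
  fix Y X J f h W e
  assume a: "Y \<in> atoms A\<Omega> (CC G E P)" "X \<in> atoms A\<Omega> (CC G E P)" "J \<in> atoms A\<Omega> (CC G E P)"
    "f \<in> gmaps A\<Omega> Y X" "h \<in> gmaps A\<Omega> J X"
    and We: "\<forall>A\<in>gorbits A\<Omega> (fiber_prod Y f J h). W A \<in> atoms A\<Omega> (CC G E P) \<and>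
        e A \<in> gisos A\<Omega> (W A) (sub_gset (fiber_prod Y f J h) A)"
  show "(- 2 :: int) ^ (atom_rank Y - atom_rank X) =
      (\<Sum>A\<in>gorbits A\<Omega> (fiber_prod Y f J h). (- 2) ^ (atom_rank (W A) - atom_rank J))"
    by (rule fiber_sum[OF odd a]) (use We in blast)+
qed

end

theorem proposition8p8:
  fixes G :: "('g, 'm) monoid_scheme"
    and T :: "'g topology"
    and E :: "('g, nat \<times> 'g set) gset set"
    and \<Omega> :: "('i, 'g, nat \<times> 'g set) prosys"
  assumes "pro_oligomorphic G T"
    and "is_order G T E"
    and "is_pro_object G E \<Omega>"
    and "universal_pro G E \<Omega>"
    and "homogeneous_pro G E \<Omega>"
    and "odd_order G E"
  shows "\<exists>\<beta> :: ('i \<Rightarrow> ('i, nat \<times> 'g set) germ, ('i, nat \<times> 'g set) germ) gset \<Rightarrow>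
                ('i \<Rightarrow> ('i, nat \<times> 'g set) germ, ('i, nat \<times> 'g set) germ) gset \<Rightarrow>
                (('i, nat \<times> 'g set) germ \<Rightarrow> ('i, nat \<times> 'g set) germ) \<Rightarrow> int.
           order_measure (pro_Aut G \<Omega>) (CC G E \<Omega>) \<beta> \<and>
           (\<forall>X\<in>nonempty_objs E. \<forall>p.
              \<beta> (BB G \<Omega> X) (point_gset p) (\<lambda>a\<in>pts (BB G \<Omega> X). p) =
                (- 2) ^ (card (gorbits G X) - 1))"
proof -
  interpret universal_homogeneous G T E \<Omega>
  proof
    show "is_gset G X" if "X \<in> E" for X
      using that is_orderD(1)[OF assms(2)] SG_gset by blast
  qed (use assms in auto)
  let ?\<beta> = "\<lambda>Y X (f :: ('i, nat \<times> 'g set) germ \<Rightarrow> ('i, nat \<times> 'g set) germ).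
    (- 2 :: int) ^ (atom_rank Y - atom_rank X)"
  have "\<forall>X\<in>nonempty_objs E. \<forall>p. ?\<beta> (BB G \<Omega> X) (point_gset p) (\<lambda>a\<in>pts (BB G \<Omega> X). p) =
      (- 2) ^ (card (gorbits G X) - 1)"
    by (simp add: atom_rank_B atom_rank_point)
  then show ?thesis using order_measure_rank[OF assms(6)] by (intro exI[of _ ?\<beta>]) blast
qed

end
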